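(* Let $T$ be a tree with $n$ vertices and diameter $d \geq 3$. For $0 \leq \alpha < 1$, $\rho_\alpha(T) \leq \rho_\alpha(T_{n,d})$, with equality if and only if $T \cong T_{n,d}$.
   Context: All graphs are finite, simple and undirected. For a graph $G$, $A(G)$ is its adjacency matrix and $D(G)$ the diagonal matrix of vertex degrees. For $\alpha\in[0,1]$, $A_\alpha(G) = \alpha D(G) + (1-\alpha)A(G)$, and $\rho_\alpha(G)$ is the largest eigenvalue of $A_\alpha(G)$. For $3 \leq d \leq n-1$, $T_{n,d}$ is the tree obtained from a path $v_0v_1\cdots v_d$ of length $d$ by attaching $n-1-d$ pendant edges at the vertex $v_{\lfloor d/2 \rfloor}$. *)

theory Defs
  imports
    "Graph_Theory.Digraph_Component"
    "Graph_Theory.Digraph_Isomorphism"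
    "Graph_Theory.Shortest_Path"
    "Jordan_Normal_Form.Spectral_Radius"
begin

text \<open>
  Finite simple undirected graphs are loop-free symmetric pair digraphs (locale \<^locale>\<open>pair_graph\<close>):
  an edge $uv$ is the pair of arcs $(u,v)$ and $(v,u)$.

  \<^const>\<open>Digraph_Component.tree\<close> is not usable for them, since there the arcs $(u,v),(v,u)$ of a
  single edge already form a cycle.  In a simple undirected graph, cycles are those of length at
  least 3.
\<close>

definition undirected_tree :: "'a pair_pre_digraph \<Rightarrow> bool" where
  "undirected_tree G \<longleftrightarrow> pair_graph G \<and> Digraph_Component.connected (with_proj G) \<and>
     \<not> (\<exists>p. pre_digraph.cycle (with_proj G) p \<and> 3 \<le> length p)"

text \<open>With unit weights, \<open>\<mu>\<close> is the usual distance, with value \<open>\<infinity>\<close> between different components.\<close>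

definition graph_diameter :: "'a pair_pre_digraph \<Rightarrow> ereal" where
  "graph_diameter G =
     (SUP u\<in>pverts G. SUP v\<in>pverts G. wf_digraph.\<mu> (with_proj G) (\<lambda>_. 1) u v)"

text \<open>
  The matrices are indexed by positions in a fixed enumeration of the vertices.  Another enumeration
  conjugates them by a permutation matrix, so the spectrum does not depend on the choice.
\<close>

definition vertex_list :: "'a pair_pre_digraph \<Rightarrow> 'a list" where
  "vertex_list G = (SOME vs. distinct vs \<and> set vs = pverts G)"

definition adjacency_matrix :: "'a pair_pre_digraph \<Rightarrow> real mat" where
  "adjacency_matrix G = (let vs = vertex_list G; n = card (pverts G) in
     Matrix.mat n n (\<lambda>(i, j). if (vs ! i, vs ! j) \<in> parcs G then 1 else 0))"

text \<open>As the arc set is symmetric, the degree of a vertex is its out-degree.\<close>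

definition degree_matrix :: "'a pair_pre_digraph \<Rightarrow> real mat" where
  "degree_matrix G = mat_diag (card (pverts G))
     (\<lambda>i. real (out_degree (with_proj G) (vertex_list G ! i)))"

definition A_alpha :: "real \<Rightarrow> 'a pair_pre_digraph \<Rightarrow> real mat" where
  "A_alpha \<alpha> G = \<alpha> \<cdot>\<^sub>m degree_matrix G + (1 - \<alpha>) \<cdot>\<^sub>m adjacency_matrix G"

text \<open>The matrix is real symmetric, so all its eigenvalues are real.\<close>

definition rho :: "real \<Rightarrow> 'a pair_pre_digraph \<Rightarrow> real" where
  "rho \<alpha> G = Max {k. eigenvalue (A_alpha \<alpha> G) k}"

text \<open>
  The path $v_0 \ldots v_d$ is $0, \ldots, d$; the pendant vertices are $d+1, \ldots, n-1$.
  Meaningful for $3 \le d \le n-1$.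
\<close>

definition T_tree :: "nat \<Rightarrow> nat \<Rightarrow> nat pair_pre_digraph" where
  "T_tree n d = \<lparr> pverts = {0..<n},
     parcs = symcl ({(i, Suc i) |i. i < d} \<union> {(d div 2, j) |j. d < j \<and> j < n}) \<rparr>"

end

theory Submission
  imports Defs "HOL-Analysis.Function_Topology"
begin

text \<open>
  $\rho_\alpha$ is the maximum of the Rayleigh quotient of $A_\alpha$, and on a connected graph it is
  attained at a positive vector $x$.

  Let $z$ be a vertex of the tree where $x$ is largest and root the tree at $z$.  A path
  $v_0 \ldots v_d$ climbs towards $z$ up to some $v_i$ and descends afterwards.  Making every vertex
  a child of $z$, except the $v_j$ with $|j - i| \ge 2$, does not decrease the quadratic form at $x$, and
  yields a path of length $d$ with all other vertices pendant at one inner vertex.  If the maximum did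
  not change, then $x$ is an eigenvector of both trees, and comparing the two eigenvalue equations at
  $z$ shows that nothing was moved.

  It remains to move the centre of such a tree from $v_i$ to $v_m$, where $i < m = \lfloor d/2 \rfloor$.  If
  $x(v_i) \le x(v_m)$, move the pendant vertices.  Otherwise reverse a segment
  $v_{i-t} \ldots v_{m+t}$ of the path.  This carries $v_i$ to position $m$, and it does not decrease
  the form for the first $t$ at which either $i - t = 0$ or $x(v_{i-t-1}) \le x(v_{m+t+1})$.
\<close>

section \<open>Maximisers of the quadratic form\<close>

text \<open>The entry of \<open>A_alpha\<close> x at v. The degree term is spread over the
  neighbours, one copy of \<alpha> x v each, so that for positive x and 0 \<le> \<alpha> < 1 every
  neighbour adds a positive amount.\<close>

definition alpha_op :: "real \<Rightarrow> 'a rel \<Rightarrow> ('a \<Rightarrow> real) \<Rightarrow> 'a \<Rightarrow> real" where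
  "alpha_op \<alpha> E x v = (\<Sum>w\<in>E `` {v}. \<alpha> * x v + (1 - \<alpha>) * x w)"

text \<open>For symmetric E this is the quadratic form of \<open>A_alpha\<close>, in which each edge
  enters through both of its arcs.\<close>

definition alpha_form :: "real \<Rightarrow> 'a rel \<Rightarrow> ('a \<Rightarrow> real) \<Rightarrow> real" where
  "alpha_form \<alpha> E x = (\<Sum>(u, v)\<in>E. \<alpha> * (x u)\<^sup>2 + (1 - \<alpha>) * x u * x v)"

definition sq_norm :: "'a set \<Rightarrow> ('a \<Rightarrow> real) \<Rightarrow> real" where
  "sq_norm V x = (\<Sum>v\<in>V. (x v)\<^sup>2)"

text \<open>Tychonoff, with the function type carrying its product topology. It allows compactness
  arguments on vertex functions themselves instead of coordinate vectors.\<close>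

lemma compact_box_fun:
  fixes K :: "'a \<Rightarrow> real set"
  assumes "\<And>i. compact (K i)"
  shows "compact {x. \<forall>i. x i \<in> K i}"
proof -
  have "compactin (product_topology (\<lambda>i. euclidean) UNIV) (PiE UNIV K)"
    using assms by (simp add: compactin_PiE)
  then show ?thesis
    by (simp add: euclidean_product_topology PiE_UNIV_domain Pi_def)
qed

locale sym_graph =
  fixes V :: "'a set" and E :: "'a rel"
  assumes finite_V: "finite V" and nonempty_V: "V \<noteq> {}"
    and E_subset: "E \<subseteq> V \<times> V" and sym_E: "sym E"
begin

lemma finite_nbrs: "finite (E `` {v})"
  using finite_V E_subset by (auto intro: finite_subset)

lemma alpha_form_eq_sum: "alpha_form \<alpha> E x = (\<Sum>v\<in>V. x v * alpha_op \<alpha> E x v)"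
proof -
  have "E = Sigma V (\<lambda>v. E `` {v})"
    using E_subset by auto
  then have "alpha_form \<alpha> E x = (\<Sum>(u, v)\<in>Sigma V (\<lambda>v. E `` {v}). \<alpha> * (x u)\<^sup>2 + (1 - \<alpha>) * x u * x v)"
    unfolding alpha_form_def by simp
  also have "\<dots> = (\<Sum>v\<in>V. \<Sum>w\<in>E `` {v}. \<alpha> * (x v)\<^sup>2 + (1 - \<alpha>) * x v * x w)"
    by (subst sum.Sigma) (auto simp: finite_V finite_nbrs)
  also have "\<dots> = (\<Sum>v\<in>V. x v * alpha_op \<alpha> E x v)"
    unfolding alpha_op_def
    by (intro sum.cong refl) (simp add: sum_distrib_left algebra_simps power2_eq_square)
  finally show ?thesis .
qed

text \<open>The form is continuous on a compact unit sphere, hence attains its maximum there;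
  homogeneity of degree 2 extends the bound to every y.\<close>

lemma exists_maximiser:
  "\<exists>\<rho> x. (\<exists>v\<in>V. x v \<noteq> 0) \<and> (\<forall>y. alpha_form \<alpha> E y \<le> \<rho> * sq_norm V y) \<and>
     alpha_form \<alpha> E x = \<rho> * sq_norm V x"
proof -
  \<comment> \<open>Coordinates outside V are pinned to 0, which keeps every factor of the product
    compact.\<close>
  define B :: "('a \<Rightarrow> real) set" where "B = {x. \<forall>i. x i \<in> (if i \<in> V then {-1..1} else {0})}"
  define S where "S = B \<inter> {x. sq_norm V x = 1}"
  have cont: "continuous_on A (\<lambda>x. sq_norm V x)" "continuous_on A (\<lambda>x. alpha_form \<alpha> E x)" for A
    unfolding sq_norm_def alpha_form_def case_prod_beta
    by (intro continuous_intros continuous_on_product_coordinates continuous_on_subset[OF continuous_on_product_coordinates] subset_UNIV)+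
  have "compact B"
    unfolding B_def by (rule compact_box_fun) auto
  moreover have "closed {x. sq_norm V x = 1}"
    by (intro closed_Collect_eq cont continuous_on_const)
  ultimately have "compact S"
    unfolding S_def by (rule compact_Int_closed)
  moreover have "S \<noteq> {}"
  proof -
    obtain v where v: "v \<in> V" using nonempty_V by auto
    have "sq_norm V (\<lambda>i. of_bool (i = v)) = (\<Sum>i\<in>V. if i = v then 1 else 0)"
      unfolding sq_norm_def by (intro sum.cong) auto
    then have "(\<lambda>i. of_bool (i = v)) \<in> S"
      using v finite_V by (auto simp: S_def B_def)
    then show ?thesis by blast
  qed
  ultimately have "\<exists>x\<in>S. \<forall>y\<in>S. alpha_form \<alpha> E y \<le> alpha_form \<alpha> E x"
    by (rule continuous_attains_sup) (rule cont)
  then obtain x where x: "x \<in> S" "\<And>y. y \<in> S \<Longrightarrow> alpha_form \<alpha> E y \<le> alpha_form \<alpha> E x"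
    by blast
  have sx: "sq_norm V x = 1" using x(1) by (simp add: S_def)
  have "alpha_form \<alpha> E y \<le> alpha_form \<alpha> E x * sq_norm V y" for y
  proof (cases "sq_norm V y = 0")
    case True
    then have "y v = 0" if "v \<in> V" for v
      using that finite_V by (simp add: sq_norm_def sum_nonneg_eq_0_iff)
    then show ?thesis by (simp add: alpha_form_eq_sum True)
  next
    case False
    define s where "s = sqrt (sq_norm V y)"
    have s: "s > 0" "s\<^sup>2 = sq_norm V y"
      using False by (auto simp: s_def sq_norm_def sum_nonneg order_less_le)
    define z where "z = (\<lambda>i. if i \<in> V then y i / s else 0)"
    have z1: "sq_norm V z = 1"
    proof -
      have "sq_norm V z = (\<Sum>v\<in>V. (y v)\<^sup>2 / s\<^sup>2)"
        unfolding sq_norm_def z_def by (intro sum.cong) (auto simp: power_divide)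
      also have "\<dots> = sq_norm V y / s\<^sup>2"
        by (simp add: sq_norm_def sum_divide_distrib)
      finally show ?thesis using s False by simp
    qed
    have "\<bar>z v\<bar> \<le> 1" if "v \<in> V" for v
      using member_le_sum[of v V "\<lambda>v. (z v)\<^sup>2"] that finite_V z1
      by (simp add: sq_norm_def abs_square_le_1)
    moreover have "z v = 0" if "v \<notin> V" for v
      using that by (simp add: z_def)
    ultimately have "z \<in> S"
      using z1 by (auto simp: S_def B_def abs_le_iff minus_le_iff)
    then have le: "alpha_form \<alpha> E z \<le> alpha_form \<alpha> E x" by (rule x(2))
    have "alpha_form \<alpha> E z = (\<Sum>(u, v)\<in>E. (\<alpha> * (y u)\<^sup>2 + (1 - \<alpha>) * y u * y v) / s\<^sup>2)"
      unfolding alpha_form_def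
    proof (intro sum.cong refl, clarify)
      fix u v assume "(u, v) \<in> E"
      then have "u \<in> V" "v \<in> V" using E_subset by auto
      then show "\<alpha> * (z u)\<^sup>2 + (1 - \<alpha>) * z u * z v = (\<alpha> * (y u)\<^sup>2 + (1 - \<alpha>) * y u * y v) / s\<^sup>2"
        by (simp add: z_def power2_eq_square add_divide_distrib)
    qed
    also have "\<dots> = alpha_form \<alpha> E y / s\<^sup>2"
      unfolding alpha_form_def sum_divide_distrib by (intro sum.cong refl) auto
    finally have "alpha_form \<alpha> E y / s\<^sup>2 \<le> alpha_form \<alpha> E x"
      using le by simp
    then show ?thesis
      using s(1) unfolding s(2)[symmetric] by (simp add: pos_divide_le_eq)
  qed
  moreover have "\<exists>v\<in>V. x v \<noteq> 0"
  proof (rule ccontr)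
    assume "\<not> (\<exists>v\<in>V. x v \<noteq> 0)"
    then have "sq_norm V x = 0" by (simp add: sq_norm_def)
    then show False using sx by simp
  qed
  ultimately show ?thesis
    using sx by (intro exI[of _ "alpha_form \<alpha> E x"] exI[of _ x]) simp
qed

text \<open>Symmetry of E merges the two mixed terms, so the coefficient of 2 t is the pairing of y
  with \<open>alpha_op\<close> x. This is the derivative behind the first-order condition at a
  maximum.\<close>

lemma alpha_form_perturb:
  "alpha_form \<alpha> E (\<lambda>i. x i + t * y i) =
   alpha_form \<alpha> E x + 2 * t * (\<Sum>v\<in>V. y v * alpha_op \<alpha> E x v) + t\<^sup>2 * alpha_form \<alpha> E y"
proof -
  have swap: "(\<Sum>(u, v)\<in>E. g u v) = (\<Sum>(u, v)\<in>E. g v u)" for g :: "'a \<Rightarrow> 'a \<Rightarrow> real"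
    by (rule sum.reindex_bij_witness[of _ prod.swap prod.swap]) (use sym_E in \<open>auto dest: symD\<close>)
  have "E = Sigma V (\<lambda>v. E `` {v})"
    using E_subset by auto
  then have "(\<Sum>(u, v)\<in>E. y u * (\<alpha> * x u + (1 - \<alpha>) * x v)) =
      (\<Sum>(u, v)\<in>Sigma V (\<lambda>v. E `` {v}). y u * (\<alpha> * x u + (1 - \<alpha>) * x v))"
    by simp
  also have "\<dots> = (\<Sum>v\<in>V. y v * alpha_op \<alpha> E x v)"
    unfolding alpha_op_def sum_distrib_left
    by (subst sum.Sigma) (auto simp: finite_V finite_nbrs)
  finally have op: "(\<Sum>(u, v)\<in>E. y u * (\<alpha> * x u + (1 - \<alpha>) * x v)) = (\<Sum>v\<in>V. y v * alpha_op \<alpha> E x v)" .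
  have "alpha_form \<alpha> E (\<lambda>i. x i + t * y i) =
      alpha_form \<alpha> E x + t * (\<Sum>(u, v)\<in>E. 2 * \<alpha> * x u * y u + (1 - \<alpha>) * (y u * x v + y v * x u)) + t\<^sup>2 * alpha_form \<alpha> E y"
    unfolding alpha_form_def sum_distrib_left sum.distrib[symmetric]
    by (intro sum.cong refl) (auto simp: algebra_simps power2_eq_square)
  moreover have "(\<Sum>(u, v)\<in>E. 2 * \<alpha> * x u * y u + (1 - \<alpha>) * (y u * x v + y v * x u)) =
      2 * (\<Sum>(u, v)\<in>E. y u * (\<alpha> * x u + (1 - \<alpha>) * x v)) +
      (1 - \<alpha>) * ((\<Sum>(u, v)\<in>E. y v * x u) - (\<Sum>(u, v)\<in>E. y u * x v))"
    unfolding sum_distrib_left sum_subtractf[symmetric] sum.distrib[symmetric]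
    by (intro sum.cong refl) (auto simp: algebra_simps)
  ultimately show ?thesis
    using swap[of "\<lambda>u v. y v * x u"] by (simp add: op)
qed

text \<open>First-order condition: perturbing x by t times the indicator of v gives 2 t b \<le> t^2
  c for all t, where b is the defect of the eigenvalue equation at v. This forces b = 0.\<close>

lemma maximiser_eigen:
  assumes bound: "\<And>y. alpha_form \<alpha> E y \<le> \<rho> * sq_norm V y"
    and max: "alpha_form \<alpha> E x = \<rho> * sq_norm V x" and v: "v \<in> V"
  shows "alpha_op \<alpha> E x v = \<rho> * x v"
proof -
  define e :: "'a \<Rightarrow> real" where "e = (\<lambda>i. of_bool (i = v))"
  define b where "b = alpha_op \<alpha> E x v - \<rho> * x v"
  define c where "c = \<rho> * sq_norm V e - alpha_form \<alpha> E e"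
  have pick: "(\<Sum>i\<in>V. e i * f i) = f v" for f :: "'a \<Rightarrow> real"
  proof -
    have "(\<Sum>i\<in>V. e i * f i) = (\<Sum>i\<in>V. if i = v then f i else 0)"
      by (intro sum.cong) (auto simp: e_def)
    then show ?thesis using v finite_V by simp
  qed
  have norm: "sq_norm V (\<lambda>i. x i + t * e i) = sq_norm V x + 2 * t * x v + t\<^sup>2 * sq_norm V e" for t
    unfolding pick[of x, symmetric] sq_norm_def sum_distrib_left sum.distrib[symmetric]
    by (intro sum.cong refl) (simp add: algebra_simps power2_eq_square)
  have ineq: "2 * t * b \<le> t\<^sup>2 * c" for t
    using bound[of "\<lambda>i. x i + t * e i"] max
    by (simp add: alpha_form_perturb norm pick b_def c_def algebra_simps)
  have "b = 0"
  proof (rule ccontr)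
    assume "b \<noteq> 0"
    \<comment> \<open>This t makes t^2 (1 + |c|) equal to t b, so the inequality becomes 2 t b \<le>
      t b although t b is positive.\<close>
    define t where "t = b / (1 + \<bar>c\<bar>)"
    have "2 * t * b \<le> t\<^sup>2 * c" by (rule ineq)
    also have "\<dots> \<le> t\<^sup>2 * (1 + \<bar>c\<bar>)" by (intro mult_left_mono) auto
    also have "\<dots> = t * b" by (simp add: t_def power2_eq_square)
    finally have "t * b \<le> 0" by (simp add: mult.commute)
    moreover have "t * b > 0"
      using \<open>b \<noteq> 0\<close> by (auto simp: t_def zero_less_divide_iff zero_less_mult_iff linorder_neq_iff)
    ultimately show False by simp
  qed
  then show ?thesis by (simp add: b_def)
qed

text \<open>Taking absolute values keeps the norm and does not decrease the form, so |x| is a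
  maximiser too. By the eigenvalue equation a zero of it spreads to all neighbours and, by
  connectedness, to all of V.\<close>

lemma positive_maximiser:
  assumes \<alpha>: "0 \<le> \<alpha>" "\<alpha> < 1" and conn: "\<And>u v. u \<in> V \<Longrightarrow> v \<in> V \<Longrightarrow> (u, v) \<in> E\<^sup>*"
    and bound: "\<And>y. alpha_form \<alpha> E y \<le> \<rho> * sq_norm V y"
    and max: "alpha_form \<alpha> E x = \<rho> * sq_norm V x" and nz: "\<exists>v\<in>V. x v \<noteq> 0"
  shows "\<exists>y. (\<forall>v\<in>V. y v > 0) \<and> alpha_form \<alpha> E y = \<rho> * sq_norm V y"
proof -
  define y where "y = (\<lambda>i. \<bar>x i\<bar>)"
  have "alpha_form \<alpha> E x \<le> alpha_form \<alpha> E y"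
    unfolding alpha_form_def
  proof (intro sum_mono, clarify)
    fix u v
    have "x u * x v \<le> y u * y v" by (simp add: y_def abs_mult[symmetric])
    then have "(1 - \<alpha>) * (x u * x v) \<le> (1 - \<alpha>) * (y u * y v)"
      using \<alpha> by (intro mult_left_mono) auto
    then show "\<alpha> * (x u)\<^sup>2 + (1 - \<alpha>) * x u * x v \<le> \<alpha> * (y u)\<^sup>2 + (1 - \<alpha>) * y u * y v"
      by (simp add: y_def mult.assoc)
  qed
  moreover have "sq_norm V y = sq_norm V x" by (simp add: sq_norm_def y_def)
  ultimately have ymax: "alpha_form \<alpha> E y = \<rho> * sq_norm V y"
    using bound[of y] max by simp
  have step: "y v = 0" if "(u, v) \<in> E" "y u = 0" for u v
  proof -
    have "u \<in> V" using that E_subset by auto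
    then have "alpha_op \<alpha> E y u = 0"
      using maximiser_eigen[OF bound ymax] that by simp
    then have "(\<Sum>w\<in>E `` {u}. (1 - \<alpha>) * y w) = 0"
      by (simp add: alpha_op_def that(2))
    then have "\<forall>w\<in>E `` {u}. (1 - \<alpha>) * y w = 0"
      using \<alpha> by (subst (asm) sum_nonneg_eq_0_iff) (auto simp: finite_nbrs y_def)
    then show ?thesis using that \<alpha> by auto
  qed
  have "y v > 0" if v: "v \<in> V" for v
  proof (rule ccontr)
    assume "\<not> y v > 0"
    then have "y v = 0" by (simp add: y_def)
    have "y w = 0" if "w \<in> V" for w
      using conn[OF v that] by (induction rule: rtrancl_induct) (auto simp: \<open>y v = 0\<close> step)
    then show False using nz by (auto simp: y_def)
  qed
  then show ?thesis using ymax by blast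
qed

end

section \<open>From the matrix \<open>A_alpha\<close> to the form on vertex functions\<close>

lemma vertex_list_props:
  assumes "finite (pverts G)"
  shows "distinct (vertex_list G)" "set (vertex_list G) = pverts G"
    "length (vertex_list G) = card (pverts G)"
proof -
  have "\<exists>vs. distinct vs \<and> set vs = pverts G"
    using finite_distinct_list[OF assms] by blast
  then have *: "distinct (vertex_list G) \<and> set (vertex_list G) = pverts G"
    unfolding vertex_list_def by (rule someI_ex)
  then show "distinct (vertex_list G)" "set (vertex_list G) = pverts G"
    by auto
  then show "length (vertex_list G) = card (pverts G)"
    by (metis distinct_card)
qed

lemma A_alpha_carrier: "A_alpha \<alpha> G \<in> carrier_mat (card (pverts G)) (card (pverts G))"
  by (simp add: A_alpha_def degree_matrix_def adjacency_matrix_def mat_diag_def Let_def)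

lemma pair_graph_sym_graph:
  assumes "pair_graph G" "pverts G \<noteq> {}"
  shows "sym_graph (pverts G) (parcs G)"
proof -
  interpret pair_graph G by fact
  show ?thesis
    using assms(2) pair_finite_verts pair_sym_arcs wellformed'
    by unfold_locales (auto simp: symmetric_def)
qed

lemma A_alpha_mult_vec:
  assumes "pair_graph G" "pverts G \<noteq> {}"
  shows "A_alpha \<alpha> G *\<^sub>v vec (card (pverts G)) (\<lambda>j. y (vertex_list G ! j)) =
    vec (card (pverts G)) (\<lambda>i. alpha_op \<alpha> (parcs G) y (vertex_list G ! i))"
proof -
  interpret sym_graph "pverts G" "parcs G"
    using assms by (rule pair_graph_sym_graph)
  let ?n = "card (pverts G)" and ?vs = "vertex_list G" and ?E = "parcs G"
  note vs = vertex_list_props[OF finite_V]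
  have bij: "bij_betw ((!) ?vs) {0..<?n} (pverts G)"
    using bij_betw_nth[OF vs(1) _ vs(2)[symmetric]] vs(3) by (simp add: lessThan_atLeast0)
  have "(A_alpha \<alpha> G *\<^sub>v vec ?n (\<lambda>j. y (?vs ! j))) $ i = alpha_op \<alpha> ?E y (?vs ! i)" if i: "i < ?n" for i
  proof -
    let ?v = "?vs ! i"
    have "{e \<in> ?E. fst e = ?v} = Pair ?v ` (?E `` {?v})" by auto
    then have deg: "out_degree (with_proj G) ?v = card (?E `` {?v})"
      by (simp add: out_degree_def out_arcs_def card_image inj_on_def)
    have "(A_alpha \<alpha> G *\<^sub>v vec ?n (\<lambda>j. y (?vs ! j))) $ i =
        (\<Sum>j\<in>{0..<?n}. (\<alpha> * (if i = j then real (card (?E `` {?v})) else 0) +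
          (1 - \<alpha>) * (if (?v, ?vs ! j) \<in> ?E then 1 else 0)) * y (?vs ! j))"
      using i by (auto simp: A_alpha_def degree_matrix_def adjacency_matrix_def mat_diag_def Let_def
          scalar_prod_def deg intro!: sum.cong)
    also have "\<dots> = (\<Sum>j\<in>{0..<?n}. (if i = j then \<alpha> * real (card (?E `` {?v})) * y (?vs ! j) else 0)) +
        (\<Sum>j\<in>{0..<?n}. (if (?v, ?vs ! j) \<in> ?E then (1 - \<alpha>) * y (?vs ! j) else 0))"
      unfolding sum.distrib[symmetric] by (intro sum.cong refl) (auto simp: algebra_simps)
    also have "(\<Sum>j\<in>{0..<?n}. (if i = j then \<alpha> * real (card (?E `` {?v})) * y (?vs ! j) else 0)) =
        (\<Sum>w\<in>?E `` {?v}. \<alpha> * y ?v)"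
      using i by simp
    also have "(\<Sum>j\<in>{0..<?n}. (if (?v, ?vs ! j) \<in> ?E then (1 - \<alpha>) * y (?vs ! j) else 0)) =
        (\<Sum>w\<in>pverts G. (if (?v, w) \<in> ?E then (1 - \<alpha>) * y w else 0))"
      by (rule sum.reindex_bij_betw[OF bij])
    also have "\<dots> = (\<Sum>w\<in>?E `` {?v}. (1 - \<alpha>) * y w)"
      using E_subset finite_V by (intro sum.mono_neutral_cong_right) auto
    finally show ?thesis by (simp add: alpha_op_def sum.distrib)
  qed
  then show ?thesis
    using A_alpha_carrier[of \<alpha> G] by (intro eq_vecI) auto
qed

text \<open>\<open>emb\<close> reads a vertex function as a vector through the enumeration and
  reaches every vector of the right dimension, so the enumeration disappears from the eigenvalue
  problem.\<close>

lemma eigenvalue_A_alpha_iff: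
  assumes "pair_graph G" "pverts G \<noteq> {}"
  shows "eigenvalue (A_alpha \<alpha> G) k \<longleftrightarrow>
    (\<exists>y. (\<exists>v\<in>pverts G. y v \<noteq> 0) \<and> (\<forall>v\<in>pverts G. alpha_op \<alpha> (parcs G) y v = k * y v))"
proof -
  interpret sym_graph "pverts G" "parcs G"
    using assms by (rule pair_graph_sym_graph)
  let ?n = "card (pverts G)" and ?vs = "vertex_list G"
  note vs = vertex_list_props[OF finite_V]
  have in_V: "(\<forall>v\<in>pverts G. P v) \<longleftrightarrow> (\<forall>i<?n. P (?vs ! i))" for P
    using vs by (metis in_set_conv_nth)
  define emb where "emb y = vec ?n (\<lambda>i. y (?vs ! i))" for y :: "'a \<Rightarrow> real"
  have emb: "eigenvector (A_alpha \<alpha> G) (emb y) k \<longleftrightarrow>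
      (\<exists>v\<in>pverts G. y v \<noteq> 0) \<and> (\<forall>v\<in>pverts G. alpha_op \<alpha> (parcs G) y v = k * y v)" for y
  proof -
    have "emb y \<noteq> 0\<^sub>v ?n \<longleftrightarrow> \<not> (\<forall>v\<in>pverts G. y v = 0)"
      unfolding in_V by (auto simp: emb_def vec_eq_iff)
    moreover have "A_alpha \<alpha> G *\<^sub>v emb y = k \<cdot>\<^sub>v emb y \<longleftrightarrow>
        (\<forall>v\<in>pverts G. alpha_op \<alpha> (parcs G) y v = k * y v)"
      unfolding emb_def A_alpha_mult_vec[OF assms] in_V by (auto simp: vec_eq_iff)
    ultimately show ?thesis
      using A_alpha_carrier[of \<alpha> G] by (auto simp: eigenvector_def emb_def)
  qed
  have "\<exists>y. w = emb y" if "w \<in> carrier_vec ?n" for w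
  proof
    have "the_inv_into {..<?n} ((!) ?vs) (?vs ! i) = i" if "i < ?n" for i
      using that vs by (intro the_inv_into_f_f) (auto simp: inj_on_def nth_eq_iff_index_eq)
    then show "w = emb (\<lambda>v. w $ the_inv_into {..<?n} ((!) ?vs) v)"
      using that by (intro eq_vecI) (auto simp: emb_def)
  qed
  then have "eigenvalue (A_alpha \<alpha> G) k \<longleftrightarrow> (\<exists>y. eigenvector (A_alpha \<alpha> G) (emb y) k)"
    using A_alpha_carrier[of \<alpha> G] unfolding eigenvalue_def eigenvector_def by fastforce
  then show ?thesis by (simp add: emb)
qed

text \<open>By the first-order condition r is an eigenvalue. At an eigenvector for k the form equals
  k times the squared norm, whence k \<le> r.\<close>

lemma rho_eqI:
  assumes G: "pair_graph G" "pverts G \<noteq> {}"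
    and bound: "\<And>y. alpha_form \<alpha> (parcs G) y \<le> r * sq_norm (pverts G) y"
    and max: "alpha_form \<alpha> (parcs G) x = r * sq_norm (pverts G) x" and nz: "\<exists>v\<in>pverts G. x v \<noteq> 0"
  shows "rho \<alpha> G = r"
  unfolding rho_def
proof (rule Max_eqI)
  interpret sym_graph "pverts G" "parcs G"
    using G by (rule pair_graph_sym_graph)
  show "finite {k. eigenvalue (A_alpha \<alpha> G) k}"
    using card_finite_spectrum(1)[OF A_alpha_carrier] by (simp add: spectrum_def)
  show "r \<in> {k. eigenvalue (A_alpha \<alpha> G) k}"
    using nz maximiser_eigen[OF bound max] by (auto simp: eigenvalue_A_alpha_iff[OF G])
  fix k assume "k \<in> {k. eigenvalue (A_alpha \<alpha> G) k}"
  then obtain y where y: "\<exists>v\<in>pverts G. y v \<noteq> 0" "\<forall>v\<in>pverts G. alpha_op \<alpha> (parcs G) y v = k * y v"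
    by (auto simp: eigenvalue_A_alpha_iff[OF G])
  have "alpha_form \<alpha> (parcs G) y = k * sq_norm (pverts G) y"
    using y(2) by (simp add: alpha_form_eq_sum sq_norm_def sum_distrib_left power2_eq_square algebra_simps)
  moreover have "sq_norm (pverts G) y > 0"
    using y(1) finite_V unfolding sq_norm_def by (metis sum_pos2 zero_le_power2 zero_less_power2)
  ultimately show "k \<le> r"
    using bound[of y] by simp
qed

lemma rho_maximiser:
  assumes G: "pair_graph G" "pverts G \<noteq> {}"
  shows "\<exists>x. (\<exists>v\<in>pverts G. x v \<noteq> 0) \<and> alpha_form \<alpha> (parcs G) x = rho \<alpha> G * sq_norm (pverts G) x"
    and alpha_form_le_rho: "alpha_form \<alpha> (parcs G) y \<le> rho \<alpha> G * sq_norm (pverts G) y"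
proof -
  interpret sym_graph "pverts G" "parcs G"
    using G by (rule pair_graph_sym_graph)
  obtain r x where rx: "\<exists>v\<in>pverts G. x v \<noteq> 0" "\<forall>y. alpha_form \<alpha> (parcs G) y \<le> r * sq_norm (pverts G) y"
      "alpha_form \<alpha> (parcs G) x = r * sq_norm (pverts G) x"
    using exists_maximiser[of \<alpha>] by blast
  moreover from this have "rho \<alpha> G = r"
    by (intro rho_eqI[OF G]) auto
  ultimately show "\<exists>x. (\<exists>v\<in>pverts G. x v \<noteq> 0) \<and> alpha_form \<alpha> (parcs G) x = rho \<alpha> G * sq_norm (pverts G) x"
    "alpha_form \<alpha> (parcs G) y \<le> rho \<alpha> G * sq_norm (pverts G) y"
    by auto
qed

lemma rho_eigen:
  assumes G: "pair_graph G"
    and max: "alpha_form \<alpha> (parcs G) x = rho \<alpha> G * sq_norm (pverts G) x" and v: "v \<in> pverts G"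
  shows "alpha_op \<alpha> (parcs G) x v = rho \<alpha> G * x v"
proof -
  have ne: "pverts G \<noteq> {}" using v by auto
  interpret sym_graph "pverts G" "parcs G"
    using G ne by (rule pair_graph_sym_graph)
  show ?thesis
    by (rule maximiser_eigen[OF alpha_form_le_rho[OF G ne] max v])
qed

lemma rho_positive_maximiser:
  assumes G: "pair_graph G" "pverts G \<noteq> {}" and \<alpha>: "0 \<le> \<alpha>" "\<alpha> < 1"
    and conn: "\<And>u v. u \<in> pverts G \<Longrightarrow> v \<in> pverts G \<Longrightarrow> (u, v) \<in> (parcs G)\<^sup>*"
  obtains x where "\<And>v. v \<in> pverts G \<Longrightarrow> x v > 0"
    "alpha_form \<alpha> (parcs G) x = rho \<alpha> G * sq_norm (pverts G) x"
proof -
  interpret sym_graph "pverts G" "parcs G"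
    using G by (rule pair_graph_sym_graph)
  show ?thesis
    using positive_maximiser[OF \<alpha> conn alpha_form_le_rho[OF G]] rho_maximiser[OF G, of \<alpha>] that by blast
qed

section \<open>The form as a sum over edges\<close>

definition edge_form :: "real \<Rightarrow> real \<Rightarrow> real \<Rightarrow> real" where
  "edge_form \<alpha> a b = \<alpha> * (a\<^sup>2 + b\<^sup>2) + 2 * (1 - \<alpha>) * a * b"

lemma edge_form_commute: "edge_form \<alpha> a b = edge_form \<alpha> b a"
  by (simp add: edge_form_def algebra_simps)

text \<open>Exchange principle: re-attaching an edge to an endpoint with a larger value of a
  positive x does not decrease the form.\<close>

lemma edge_form_mono:
  assumes "0 \<le> \<alpha>" "\<alpha> < 1" "0 < a" "0 < b" "b \<le> c"
  shows "edge_form \<alpha> a b \<le> edge_form \<alpha> a c"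
  using assms unfolding edge_form_def
  by (intro add_mono mult_left_mono power_mono mult_nonneg_nonneg order_refl) auto

lemma edge_form_mono':
  assumes "0 \<le> \<alpha>" "\<alpha> < 1" "0 < a" "0 < b" "b \<le> c"
  shows "edge_form \<alpha> b a \<le> edge_form \<alpha> c a"
  using edge_form_mono[OF assms] by (simp only: edge_form_commute[of \<alpha> a])

lemma in_symcl_iff: "(u, v) \<in> symcl F \<longleftrightarrow> (u, v) \<in> F \<or> (v, u) \<in> F"
  by (auto simp: symcl_def)

lemma alpha_form_symcl:
  assumes "finite F" and antisym: "\<And>u v. (u, v) \<in> F \<Longrightarrow> (v, u) \<notin> F"
  shows "alpha_form \<alpha> (symcl F) x = (\<Sum>(u, v)\<in>F. edge_form \<alpha> (x u) (x v))"
proof -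
  have "alpha_form \<alpha> (symcl F) x = alpha_form \<alpha> F x + alpha_form \<alpha> ((\<lambda>(a, b). (b, a)) ` F) x"
    unfolding symcl_def alpha_form_def using assms by (intro sum.union_disjoint) auto
  also have "alpha_form \<alpha> ((\<lambda>(a, b). (b, a)) ` F) x = (\<Sum>(u, v)\<in>F. \<alpha> * (x v)\<^sup>2 + (1 - \<alpha>) * x v * x u)"
    unfolding alpha_form_def by (subst sum.reindex) (auto simp: inj_on_def case_prod_beta)
  also have "alpha_form \<alpha> F x + \<dots> = (\<Sum>(u, v)\<in>F. edge_form \<alpha> (x u) (x v))"
    unfolding alpha_form_def sum.distrib[symmetric] edge_form_def
    by (intro sum.cong refl) (auto simp: algebra_simps)
  finally show ?thesis .
qed

text \<open>In a rooted tree each edge is counted once, at its child. The assumptions exclude loops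
  and vertices that are each other's parent, so no edge is counted twice.\<close>

lemma alpha_form_parent:
  assumes fin: "finite V" and "\<And>w. w \<in> V - {z} \<Longrightarrow> p w \<noteq> w"
    and "\<And>w. w \<in> V - {z} \<Longrightarrow> p w \<in> V - {z} \<Longrightarrow> p (p w) \<noteq> w"
  shows "alpha_form \<alpha> (symcl ((\<lambda>w. (w, p w)) ` (V - {z}))) x = (\<Sum>w\<in>V - {z}. edge_form \<alpha> (x w) (x (p w)))"
proof -
  have "alpha_form \<alpha> (symcl ((\<lambda>w. (w, p w)) ` (V - {z}))) x =
      (\<Sum>(u, v)\<in>(\<lambda>w. (w, p w)) ` (V - {z}). edge_form \<alpha> (x u) (x v))"
  proof (rule alpha_form_symcl)
    fix u v assume "(u, v) \<in> (\<lambda>w. (w, p w)) ` (V - {z})"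
    then have u: "u \<in> V - {z}" and v: "v = p u" by auto
    show "(v, u) \<notin> (\<lambda>w. (w, p w)) ` (V - {z})"
    proof
      assume "(v, u) \<in> (\<lambda>w. (w, p w)) ` (V - {z})"
      then have "p u \<in> V - {z}" "p (p u) = u" unfolding v by auto
      with assms(3)[OF u] show False by blast
    qed
  qed (use fin in auto)
  also have "\<dots> = (\<Sum>w\<in>V - {z}. edge_form \<alpha> (x w) (x (p w)))"
    by (subst sum.reindex) (auto simp: inj_on_def)
  finally show ?thesis .
qed

section \<open>Isomorphism and comparison\<close>

text \<open>Only the vertex map is recorded, since in a pair digraph an arc is the pair of its
  ends.\<close>

definition graph_iso :: "('a \<Rightarrow> 'b) \<Rightarrow> 'a pair_pre_digraph \<Rightarrow> 'b pair_pre_digraph \<Rightarrow> bool" where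
  "graph_iso f G H \<longleftrightarrow> bij_betw f (pverts G) (pverts H) \<and>
     (\<forall>u\<in>pverts G. \<forall>v\<in>pverts G. (u, v) \<in> parcs G \<longleftrightarrow> (f u, f v) \<in> parcs H)"

lemma pair_graph_arcs_subset: "pair_graph G \<Longrightarrow> parcs G \<subseteq> pverts G \<times> pverts G"
proof -
  assume "pair_graph G"
  then interpret pair_graph G .
  show ?thesis using wellformed' by auto
qed

lemma graph_iso_arcs:
  assumes "graph_iso f G H" "pair_graph G" "pair_graph H"
  shows "parcs H = map_prod f f ` parcs G"
proof (intro equalityI subrelI)
  note sub = pair_graph_arcs_subset[OF assms(2)] pair_graph_arcs_subset[OF assms(3)]
  have bij: "pverts H = f ` pverts G"
    using assms(1) by (simp add: graph_iso_def bij_betw_def)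
  fix u v assume uv: "(u, v) \<in> parcs H"
  then obtain a b where "a \<in> pverts G" "b \<in> pverts G" "u = f a" "v = f b"
    using sub bij by auto
  with uv assms(1) show "(u, v) \<in> map_prod f f ` parcs G"
    by (auto simp: graph_iso_def)
next
  note sub = pair_graph_arcs_subset[OF assms(2)]
  fix u v assume "(u, v) \<in> map_prod f f ` parcs G"
  with sub assms(1) show "(u, v) \<in> parcs H"
    by (auto simp: graph_iso_def)
qed

lemma graph_iso_sym:
  assumes "graph_iso f G H"
  shows "graph_iso (the_inv_into (pverts G) f) H G"
proof -
  let ?g = "the_inv_into (pverts G) f"
  have bij: "bij_betw f (pverts G) (pverts H)" using assms by (simp add: graph_iso_def)
  then have g: "bij_betw ?g (pverts H) (pverts G)" by (rule bij_betw_the_inv_into)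
  have "f (?g u) = u" "?g u \<in> pverts G" if "u \<in> pverts H" for u
    using that bij g by (simp_all add: f_the_inv_into_f_bij_betw bij_betw_apply)
  with g assms show ?thesis
    by (simp add: graph_iso_def)
qed

lemma graph_iso_trans:
  assumes "graph_iso f G H" "graph_iso g H K"
  shows "graph_iso (g \<circ> f) G K"
  using assms unfolding graph_iso_def by (auto intro: bij_betw_trans dest: bij_betwE)

text \<open>Equality of the image with \<open>with_proj H\<close> makes \<open>fst\<close> and
  \<open>snd\<close> the end maps, which forces the arc map of an isomorphism to act as the vertex
  map on both ends. Conversely, \<open>map_prod f f\<close> serves as the arc map.\<close>

lemma digraph_iso_with_proj_iff:
  assumes "pair_graph G" "pair_graph H"
  shows "digraph_iso (with_proj G) (with_proj H) \<longleftrightarrow> (\<exists>f. graph_iso f G H)"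
proof
  assume "digraph_iso (with_proj G) (with_proj H)"
  then obtain h where h: "pre_digraph.digraph_isomorphism (with_proj G) h"
      and H: "with_proj H = app_iso h (with_proj G)"
    by (auto simp: digraph_iso_def)
  have verts: "pverts H = iso_verts h ` pverts G" and arcs: "parcs H = iso_arcs h ` parcs G"
    and ends: "iso_tail h = fst" "iso_head h = snd"
    using arg_cong[OF H, of verts] arg_cong[OF H, of arcs] arg_cong[OF H, of tail] arg_cong[OF H, of head]
    by simp_all
  have inj: "inj_on (iso_verts h) (pverts G)"
    and ia: "\<And>a. a \<in> parcs G \<Longrightarrow> iso_arcs h a = map_prod (iso_verts h) (iso_verts h) a"
    using h by (auto simp: pre_digraph.digraph_isomorphism_def ends prod_eq_iff)
  have "parcs H = map_prod (iso_verts h) (iso_verts h) ` parcs G"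
    unfolding arcs using ia by (intro image_cong) auto
  moreover have "(u, v) \<in> parcs G \<longleftrightarrow>
      (iso_verts h u, iso_verts h v) \<in> map_prod (iso_verts h) (iso_verts h) ` parcs G"
    if uv: "u \<in> pverts G" "v \<in> pverts G" for u v
  proof
    assume "(iso_verts h u, iso_verts h v) \<in> map_prod (iso_verts h) (iso_verts h) ` parcs G"
    then obtain a b where ab: "(a, b) \<in> parcs G" "iso_verts h u = iso_verts h a" "iso_verts h v = iso_verts h b"
      by auto
    then have "a \<in> pverts G" "b \<in> pverts G"
      using pair_graph_arcs_subset[OF assms(1)] by auto
    with ab uv inj show "(u, v) \<in> parcs G" by (simp add: inj_on_eq_iff)
  qed auto
  ultimately have "graph_iso (iso_verts h) G H"
    using inj verts by (simp add: graph_iso_def bij_betw_def)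
  then show "\<exists>f. graph_iso f G H" by blast
next
  assume "\<exists>f. graph_iso f G H"
  then obtain f where f: "graph_iso f G H" ..
  interpret G: pair_graph G by fact
  define h where "h = \<lparr>iso_verts = f, iso_arcs = map_prod f f, iso_head = snd, iso_tail = fst\<rparr>"
  have inj: "inj_on f (pverts G)" and verts: "pverts H = f ` pverts G"
    using f by (auto simp: graph_iso_def bij_betw_def)
  have "inj_on (map_prod f f) (parcs G)"
    using inj_on_subset[OF map_prod_inj_on[OF inj inj] pair_graph_arcs_subset[OF assms(1)]] .
  then have "pre_digraph.digraph_isomorphism (with_proj G) h"
    using inj G.wf_digraph by (auto simp: pre_digraph.digraph_isomorphism_def h_def)
  moreover have "with_proj H = app_iso h (with_proj G)"
    using graph_iso_arcs[OF f assms] verts by (simp add: app_iso_def h_def with_proj_def)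
  ultimately show "digraph_iso (with_proj G) (with_proj H)"
    by (auto simp: digraph_iso_def)
qed

lemma alpha_form_iso:
  assumes "graph_iso f G H" "pair_graph G" "pair_graph H"
  shows "alpha_form \<alpha> (parcs H) y = alpha_form \<alpha> (parcs G) (y \<circ> f)"
proof -
  have "inj_on f (pverts G)"
    using assms(1) by (auto simp: graph_iso_def bij_betw_def)
  then have "inj_on (map_prod f f) (parcs G)"
    using inj_on_subset[OF map_prod_inj_on pair_graph_arcs_subset[OF assms(2)]] by blast
  then show ?thesis
    unfolding alpha_form_def graph_iso_arcs[OF assms] by (subst sum.reindex) (auto simp: case_prod_beta)
qed

lemma sq_norm_bij:
  assumes "bij_betw f V W"
  shows "sq_norm W y = sq_norm V (y \<circ> f)"
  unfolding sq_norm_def by (simp add: sum.reindex_bij_betw[OF assms, symmetric])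

text \<open>Both a maximiser and the upper bound transport along f, and together they determine
  \<open>rho\<close> by \<open>rho_eqI\<close>.\<close>

lemma rho_graph_iso:
  assumes f: "graph_iso f G H" and G: "pair_graph G" "pverts G \<noteq> {}" and H: "pair_graph H"
  shows "rho \<alpha> H = rho \<alpha> G"
proof -
  have bij: "bij_betw f (pverts G) (pverts H)" using f by (simp add: graph_iso_def)
  obtain x where x: "\<exists>v\<in>pverts G. x v \<noteq> 0" "alpha_form \<alpha> (parcs G) x = rho \<alpha> G * sq_norm (pverts G) x"
    using rho_maximiser[OF G] by blast
  define y where "y = x \<circ> the_inv_into (pverts G) f"
  have yf: "(y \<circ> f) v = x v" if "v \<in> pverts G" for v
    using that bij by (simp add: y_def the_inv_into_f_f bij_betw_def)
  have "alpha_form \<alpha> (parcs G) (y \<circ> f) = alpha_form \<alpha> (parcs G) x"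
    using pair_graph_arcs_subset[OF G(1)] unfolding alpha_form_def
    by (intro sum.cong refl) (auto simp: yf simp del: comp_apply)
  moreover have "sq_norm (pverts G) (y \<circ> f) = sq_norm (pverts G) x"
    unfolding sq_norm_def by (intro sum.cong refl) (simp add: yf del: comp_apply)
  moreover have "\<exists>v\<in>pverts H. y v \<noteq> 0"
    using x(1) yf bij by (metis bij_betwE comp_apply)
  ultimately have "alpha_form \<alpha> (parcs H) y = rho \<alpha> G * sq_norm (pverts H) y"
    and nz: "\<exists>v\<in>pverts H. y v \<noteq> 0"
    using x(2) by (simp_all only: alpha_form_iso[OF f G(1) H] sq_norm_bij[OF bij])
  moreover have "alpha_form \<alpha> (parcs H) w \<le> rho \<alpha> G * sq_norm (pverts H) w" for w
    unfolding alpha_form_iso[OF f G(1) H] sq_norm_bij[OF bij] by (rule alpha_form_le_rho[OF G])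
  moreover have "pverts H \<noteq> {}" using nz by auto
  ultimately show ?thesis
    using nz by (intro rho_eqI[OF H])
qed

text \<open>The tool of every comparison below. The maximiser of G, relabelled by a mere bijection
  of the vertices, is a trial function for H. If the radii agree it is a maximiser for H too; both
  eigenvalue equations then hold with the same eigenvalue, and the operators can be compared vertex
  by vertex.\<close>

lemma rho_compare:
  assumes G: "pair_graph G" "pverts G \<noteq> {}" and H: "pair_graph H"
    and pos: "\<And>v. v \<in> pverts G \<Longrightarrow> x v > 0"
    and max: "alpha_form \<alpha> (parcs G) x = rho \<alpha> G * sq_norm (pverts G) x"
    and bij: "bij_betw f (pverts H) (pverts G)"
    and le: "alpha_form \<alpha> (parcs G) x \<le> alpha_form \<alpha> (parcs H) (x \<circ> f)"
  shows "rho \<alpha> G \<le> rho \<alpha> H"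
    and "rho \<alpha> G = rho \<alpha> H \<Longrightarrow> v \<in> pverts H \<Longrightarrow>
      alpha_op \<alpha> (parcs H) (x \<circ> f) v = alpha_op \<alpha> (parcs G) x (f v)"
proof -
  have H_ne: "pverts H \<noteq> {}"
    using bij G(2) by (auto simp: bij_betw_def)
  have norm: "sq_norm (pverts G) x = sq_norm (pverts H) (x \<circ> f)"
    by (rule sq_norm_bij[OF bij])
  interpret sym_graph "pverts G" "parcs G"
    using G by (rule pair_graph_sym_graph)
  have "sq_norm (pverts G) x > 0"
    unfolding sq_norm_def using finite_V G(2) by (intro sum_pos) (auto dest: pos)
  moreover have bound: "alpha_form \<alpha> (parcs H) (x \<circ> f) \<le> rho \<alpha> H * sq_norm (pverts G) x"
    unfolding norm by (rule alpha_form_le_rho[OF H H_ne])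
  ultimately show "rho \<alpha> G \<le> rho \<alpha> H"
    using le max by (metis mult_le_cancel_right_pos order_trans)
  assume eq: "rho \<alpha> G = rho \<alpha> H" and v: "v \<in> pverts H"
  have "alpha_form \<alpha> (parcs H) (x \<circ> f) = rho \<alpha> H * sq_norm (pverts H) (x \<circ> f)"
    using bound le max eq norm by simp
  then have "alpha_op \<alpha> (parcs H) (x \<circ> f) v = rho \<alpha> H * (x \<circ> f) v"
    using H v by (intro rho_eigen)
  moreover have "alpha_op \<alpha> (parcs G) x (f v) = rho \<alpha> G * x (f v)"
    using bij v by (intro rho_eigen[OF G(1) max]) (auto simp: bij_betw_def)
  ultimately show "alpha_op \<alpha> (parcs H) (x \<circ> f) v = alpha_op \<alpha> (parcs G) x (f v)"
    using eq by simp
qed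

section \<open>Brooms\<close>

text \<open>\<open>T_tree\<close> with the attaching vertex as a parameter: the first comparison
  yields such a tree without control over where on the path its centre lies.\<close>

definition broom :: "nat \<Rightarrow> nat \<Rightarrow> nat \<Rightarrow> nat pair_pre_digraph" where
  "broom n d c = \<lparr> pverts = {0..<n},
     parcs = symcl ({(i, Suc i) |i. i < d} \<union> {(c, j) |j. d < j \<and> j < n}) \<rparr>"

lemma T_tree_eq_broom: "T_tree n d = broom n d (d div 2)"
  by (simp add: T_tree_def broom_def)

lemma pverts_broom [simp]: "pverts (broom n d c) = {0..<n}"
  by (simp add: broom_def)

lemma broom_arc_iff: "(u, v) \<in> parcs (broom n d c) \<longleftrightarrow>
    v = Suc u \<and> u < d \<or> u = Suc v \<and> v < d \<or> u = c \<and> d < v \<and> v < n \<or> v = c \<and> d < u \<and> u < n"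
  by (auto simp: broom_def symcl_def)

lemma pair_graph_broom:
  assumes "d < n" "c \<le> d"
  shows "pair_graph (broom n d c)"
proof -
  have sub: "parcs (broom n d c) \<subseteq> {0..<n} \<times> {0..<n}"
    using assms by (auto simp: broom_arc_iff)
  then have "finite (parcs (broom n d c))"
    by (rule finite_subset) auto
  with sub show ?thesis
    using assms
    by unfold_locales (auto simp: symmetric_def sym_def broom_arc_iff)
qed

lemma broom_connected:
  assumes "d < n" "c \<le> d" "u < n" "v < n"
  shows "(u, v) \<in> (parcs (broom n d c))\<^sup>*"
proof -
  let ?E = "parcs (broom n d c)"
  have path: "(0, j) \<in> ?E\<^sup>*" if "j \<le> d" for j
    using that by (induction j) (auto simp: broom_arc_iff intro: rtrancl_into_rtrancl)
  have zero: "(0, j) \<in> ?E\<^sup>*" if "j < n" for j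
    using that path[OF assms(2)] path[of j]
    by (cases "j \<le> d") (auto simp: broom_arc_iff intro: rtrancl_into_rtrancl)
  have "sym ?E" by (auto simp: sym_def broom_arc_iff)
  then have "sym (?E\<^sup>*)" by (rule sym_rtrancl)
  then show ?thesis
    using zero[OF assms(3)] zero[OF assms(4)] by (meson symD rtrancl_trans)
qed

lemma alpha_form_broom:
  assumes "d < n" "c \<le> d"
  shows "alpha_form \<alpha> (parcs (broom n d c)) y =
    (\<Sum>j<d. edge_form \<alpha> (y j) (y (Suc j))) + (\<Sum>j\<in>{d<..<n}. edge_form \<alpha> (y c) (y j))"
proof -
  have path: "{(i, Suc i) |i. i < d} = (\<lambda>i. (i, Suc i)) ` {..<d}" by auto
  have pend: "{(c, j) |j. d < j \<and> j < n} = Pair c ` {d<..<n}" by auto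
  have "alpha_form \<alpha> (parcs (broom n d c)) y =
      (\<Sum>(u, v)\<in>(\<lambda>i. (i, Suc i)) ` {..<d} \<union> Pair c ` {d<..<n}. edge_form \<alpha> (y u) (y v))"
    unfolding broom_def path pend using assms by (simp, intro alpha_form_symcl) auto
  also have "\<dots> = (\<Sum>(u, v)\<in>(\<lambda>i. (i, Suc i)) ` {..<d}. edge_form \<alpha> (y u) (y v)) +
      (\<Sum>(u, v)\<in>Pair c ` {d<..<n}. edge_form \<alpha> (y u) (y v))"
    using assms by (intro sum.union_disjoint) auto
  also have "\<dots> = (\<Sum>j<d. edge_form \<alpha> (y j) (y (Suc j))) + (\<Sum>j\<in>{d<..<n}. edge_form \<alpha> (y c) (y j))"
    by (simp add: sum.reindex inj_on_def)
  finally show ?thesis .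
qed

text \<open>The next vertex towards c, which turns the broom into a tree rooted at its
  centre.\<close>

definition broom_parent :: "nat \<Rightarrow> nat \<Rightarrow> nat \<Rightarrow> nat" where
  "broom_parent d c j = (if j < c then Suc j else if j \<le> d then j - 1 else c)"

lemma broom_arcs_parent:
  assumes "d < n" "c \<le> d"
  shows "parcs (broom n d c) = symcl ((\<lambda>j. (j, broom_parent d c j)) ` ({0..<n} - {c}))"
proof -
  have "(u, v) \<in> parcs (broom n d c) \<longleftrightarrow>
    u < n \<and> u \<noteq> c \<and> v = broom_parent d c u \<or> v < n \<and> v \<noteq> c \<and> u = broom_parent d c v" for u v
    unfolding broom_arc_iff broom_parent_def using assms by auto
  then show ?thesis
    by (auto simp: in_symcl_iff)
qed

lemma alpha_form_broom_parent:
  assumes "d < n" "c \<le> d"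
  shows "alpha_form \<alpha> (parcs (broom n d c)) y = (\<Sum>j\<in>{0..<n} - {c}. edge_form \<alpha> (y j) (y (broom_parent d c j)))"
  unfolding broom_arcs_parent[OF assms]
  using assms by (intro alpha_form_parent) (auto simp: broom_parent_def split: if_splits)

text \<open>The path is read backwards and the pendant vertices stay. This reduces the search for
  the best centre to the left half of the path.\<close>

lemma broom_reflect:
  assumes "d < n" "c \<le> d"
  shows "graph_iso (\<lambda>j. if j \<le> d then d - j else j) (broom n d c) (broom n d (d - c))"
proof -
  let ?f = "\<lambda>j. if j \<le> d then d - j else j"
  have "bij_betw ?f {0..<n} {0..<n}"
    using assms by (intro bij_betw_byWitness[where f' = ?f]) auto
  moreover have "(u, v) \<in> parcs (broom n d c) \<longleftrightarrow> (?f u, ?f v) \<in> parcs (broom n d (d - c))" for u v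
    unfolding broom_arc_iff using assms by (auto split: if_splits)
  ultimately show ?thesis
    by (simp add: graph_iso_def)
qed

section \<open>Moving the centre of a broom\<close>

text \<open>Edges inside the segment are only permuted, so the sum changes at the two boundary edges
  alone. The right one exists because R < d; the left one is missing if L = 0.\<close>

lemma path_form_reverse_segment:
  fixes h :: "real \<Rightarrow> real \<Rightarrow> real" and L R d :: nat
  assumes comm: "\<And>a b. h a b = h b a" and LR: "L \<le> R" "R < d"
    and f_def: "f = (\<lambda>j. if L \<le> j \<and> j \<le> R then L + R - j else j)"
  shows "(\<Sum>j<d. h (x (f j)) (x (f (Suc j)))) = (\<Sum>j<d. h (x j) (x (Suc j))) +
    (h (x L) (x (Suc R)) - h (x R) (x (Suc R))) +
    (if L = 0 then 0 else h (x (L - 1)) (x R) - h (x (L - 1)) (x L))"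
proof -
  define g where "g j = h (x j) (x (Suc j))" for j
  define g' where "g' j = h (x (f j)) (x (f (Suc j)))" for j
  have split: "sum k {..<d} = sum k {..<L} + sum k {L..<R} + k R + sum k {Suc R..<d}" for k :: "nat \<Rightarrow> real"
  proof -
    have "sum k {..<d} = sum k {0..<L} + sum k {L..<d}"
      unfolding lessThan_atLeast0 by (rule sum.atLeastLessThan_concat[symmetric]) (use LR in auto)
    also have "sum k {L..<d} = sum k {L..<R} + sum k {R..<d}"
      by (rule sum.atLeastLessThan_concat[symmetric]) (use LR in auto)
    also have "sum k {R..<d} = k R + sum k {Suc R..<d}"
      by (rule sum.atLeast_Suc_lessThan) (use LR in auto)
    finally show ?thesis by (simp add: lessThan_atLeast0)
  qed
  have "sum g' {L..<R} = sum g {L..<R}"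
  \<comment> \<open>Edge j of the reversed segment is edge L + R - 1 - j of the original one,
    traversed backwards.\<close>
  proof (rule sum.reindex_bij_witness[of _ "\<lambda>j. L + R - Suc j" "\<lambda>j. L + R - Suc j"])
    fix j assume j: "j \<in> {L..<R}"
    then have "f j = Suc (L + R - Suc j)" "f (Suc j) = L + R - Suc j"
      by (auto simp: f_def)
    then show "g (L + R - Suc j) = g' j"
      by (simp add: g_def g'_def comm)
  qed auto
  moreover have "sum g' {Suc R..<d} = sum g {Suc R..<d}"
    by (intro sum.cong) (auto simp: g_def g'_def f_def)
  moreover have "g' R = h (x L) (x (Suc R))" "g R = h (x R) (x (Suc R))"
    using LR by (auto simp: g_def g'_def f_def)
  moreover have "sum g' {..<L} = sum g {..<L} + (if L = 0 then 0 else h (x (L - 1)) (x R) - h (x (L - 1)) (x L))"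
  proof (cases L)
    case (Suc l)
    have "sum g' {..<l} = sum g {..<l}"
      by (intro sum.cong) (auto simp: g_def g'_def f_def Suc)
    moreover have "g' l = h (x l) (x R)" "g l = h (x l) (x L)"
      using LR by (auto simp: g_def g'_def f_def Suc)
    ultimately show ?thesis by (simp add: Suc)
  qed simp
  ultimately have "sum g' {..<d} = sum g {..<d} + (h (x L) (x (Suc R)) - h (x R) (x (Suc R))) +
    (if L = 0 then 0 else h (x (L - 1)) (x R) - h (x (L - 1)) (x L))"
    by (simp add: split)
  then show ?thesis by (simp add: g_def g'_def)
qed

text \<open>A path vertex to the right of the centre has no pendant neighbours. At such a vertex the
  eigenvalue equations of two brooms are compared.\<close>

lemma alpha_op_broom_path:
  assumes "c \<le> v" "v < d"
  shows "alpha_op \<alpha> (parcs (broom n d c)) x (Suc v) =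
    (\<alpha> * x (Suc v) + (1 - \<alpha>) * x v) +
    (if Suc v < d then \<alpha> * x (Suc v) + (1 - \<alpha>) * x (Suc (Suc v)) else 0)"
proof -
  have "parcs (broom n d c) `` {Suc v} = (if Suc v < d then {v, Suc (Suc v)} else {v})"
    using assms by (auto simp: broom_arc_iff)
  then show ?thesis
    by (auto simp: alpha_op_def)
qed

text \<open>In both cases a rearrangement of the positive maximiser for centre i does at least as
  well for centre m, and strictness comes from one vertex where the two eigenvalue equations are
  incompatible. \<open>Suc d < n\<close> provides a pendant vertex; without one both brooms are the
  same path.\<close>

lemma rho_broom_less:
  assumes \<alpha>: "0 \<le> \<alpha>" "\<alpha> < 1" and im: "i < m" "2 * m \<le> d" and n: "Suc d < n"
  shows "rho \<alpha> (broom n d i) < rho \<alpha> (broom n d m)"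
proof -
  let ?G = "broom n d i" and ?H = "broom n d m"
  have G: "pair_graph ?G" and ne: "pverts ?G \<noteq> {}" and H: "pair_graph ?H"
    using im n by (auto intro!: pair_graph_broom)
  obtain x where pos: "\<And>v. v \<in> pverts ?G \<Longrightarrow> x v > 0"
    and max: "alpha_form \<alpha> (parcs ?G) x = rho \<alpha> ?G * sq_norm (pverts ?G) x"
    by (rule rho_positive_maximiser[OF G ne \<alpha>]) (use im n in \<open>auto intro!: broom_connected\<close>)
  have x_pos: "x v > 0" if "v < n" for v
    using pos[of v] that by simp
  have formG: "alpha_form \<alpha> (parcs ?G) y =
      (\<Sum>j<d. edge_form \<alpha> (y j) (y (Suc j))) + (\<Sum>j\<in>{d<..<n}. edge_form \<alpha> (y i) (y j))" for y
    using im n by (intro alpha_form_broom) auto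
  have formH: "alpha_form \<alpha> (parcs ?H) y =
      (\<Sum>j<d. edge_form \<alpha> (y j) (y (Suc j))) + (\<Sum>j\<in>{d<..<n}. edge_form \<alpha> (y m) (y j))" for y
    using im n by (intro alpha_form_broom) auto
  show ?thesis
  proof (cases "x i \<le> x m")
    case True
    have "alpha_form \<alpha> (parcs ?G) x \<le> alpha_form \<alpha> (parcs ?H) (x \<circ> id)"
      unfolding formG formH comp_id
    proof (intro add_mono sum_mono order_refl)
      fix j assume "j \<in> {d<..<n}"
      then show "edge_form \<alpha> (x i) (x j) \<le> edge_form \<alpha> (x m) (x j)"
        using True im \<alpha> x_pos by (intro edge_form_mono') auto
    qed
    note cmp = rho_compare[OF G ne H pos max _ this]
    have le: "rho \<alpha> ?G \<le> rho \<alpha> ?H"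
      by (rule cmp) auto
    have "rho \<alpha> ?G \<noteq> rho \<alpha> ?H"
    proof
      assume "rho \<alpha> ?G = rho \<alpha> ?H"
      then have "alpha_op \<alpha> (parcs ?H) (x \<circ> id) m = alpha_op \<alpha> (parcs ?G) x (id m)"
        by (intro cmp(2)) (use im n in auto)
      \<comment> \<open>Moving the pendant vertices gives m new neighbours, among them
        \<open>Suc d\<close>, and takes none away; as x is positive, the value grows
        strictly.\<close>
      moreover have "alpha_op \<alpha> (parcs ?G) x m < alpha_op \<alpha> (parcs ?H) x m"
        unfolding alpha_op_def
      proof (rule sum_strict_mono2)
        interpret H: sym_graph "pverts ?H" "parcs ?H"
          using H ne by (intro pair_graph_sym_graph) auto
        show "finite (parcs ?H `` {m})" by (rule H.finite_nbrs)
        show "parcs ?G `` {m} \<subseteq> parcs ?H `` {m}"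
          using im n by (auto simp: broom_arc_iff)
        show "Suc d \<in> parcs ?H `` {m} - parcs ?G `` {m}"
          using im n by (auto simp: broom_arc_iff)
        show "0 < \<alpha> * x m + (1 - \<alpha>) * x (Suc d)"
          using \<alpha> im n by (intro add_nonneg_pos mult_nonneg_nonneg mult_pos_pos less_imp_le[OF x_pos] x_pos) auto
        fix w assume "w \<in> parcs ?H `` {m}"
        then show "0 \<le> \<alpha> * x m + (1 - \<alpha>) * x w"
          using \<alpha> im n
          by (intro add_nonneg_nonneg mult_nonneg_nonneg less_imp_le[OF x_pos]) (auto simp: broom_arc_iff)
      qed
      ultimately show False by simp
    qed
    with le show ?thesis by simp
  next
    case False
    \<comment> \<open>The segment from i to m grows by one vertex on each side until it meets the
      left end of the path, or until its left outer neighbour has at most the value of the right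
      one. \<open>P i\<close> guarantees that this stops.\<close>
    define P where "P t \<longleftrightarrow> t = i \<or> x (i - Suc t) \<le> x (m + Suc t)" for t
    define t where "t = (LEAST t. P t)"
    have "P i" by (simp add: P_def)
    then have "P t" and "t \<le> i"
      unfolding t_def by (rule LeastI, rule Least_le)
    have before: "\<not> P s" if "s < t" for s
      using that not_less_Least unfolding t_def by blast
    define L R where "L = i - t" and "R = m + t"
    \<comment> \<open>R < d follows from t \<le> i < m and 2 m \<le> d. As L + R = i + m, the
      reversal exchanges i and m.\<close>
    have LR: "L \<le> m" "m \<le> R" "L \<le> R" "R < d" "L + R = i + m"
      using im \<open>t \<le> i\<close> by (auto simp: L_def R_def)
    \<comment> \<open>For t = 0 this is the case assumption x m < x i; otherwise it is the failure
      of P at t - 1.\<close>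
    have gt: "x R < x L"
    proof (cases t)
      case 0
      then show ?thesis using False by (simp add: L_def R_def)
    next
      case (Suc s)
      then show ?thesis using before[of s] by (simp add: L_def R_def P_def)
    qed
    define f where "f = (\<lambda>j. if L \<le> j \<and> j \<le> R then L + R - j else j)"
    have bij: "bij_betw f (pverts ?H) (pverts ?G)"
      by (rule bij_betw_byWitness[where f' = f]) (use LR n in \<open>auto simp: f_def\<close>)
    have "0 \<le> (edge_form \<alpha> (x L) (x (Suc R)) - edge_form \<alpha> (x R) (x (Suc R))) +
      (if L = 0 then 0 else edge_form \<alpha> (x (L - 1)) (x R) - edge_form \<alpha> (x (L - 1)) (x L))"
    proof (cases "L = 0")
      case True
      then show ?thesis
        using edge_form_mono'[of \<alpha> "x (Suc R)" "x R" "x L"] \<alpha> gt x_pos LR n by simp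
    next
      case False
      then have "x (L - 1) \<le> x (Suc R)"
        using \<open>P t\<close> by (simp add: P_def L_def R_def)
      \<comment> \<open>The squares in the two boundary changes cancel, and their sum is exactly
        this product; both differences in it are nonnegative.\<close>
      then have "0 \<le> 2 * (1 - \<alpha>) * ((x L - x R) * (x (Suc R) - x (L - 1)))"
        using \<alpha> gt by simp
      then show ?thesis
        using False by (simp add: edge_form_def algebra_simps)
    qed
    moreover have "f m = i"
      using LR by (auto simp: f_def)
    moreover have "(\<Sum>j\<in>{d<..<n}. edge_form \<alpha> (x i) (x (f j))) = (\<Sum>j\<in>{d<..<n}. edge_form \<alpha> (x i) (x j))"
      using LR by (intro sum.cong) (auto simp: f_def)
    moreover note path_form_reverse_segment[of "edge_form \<alpha>" L R d f x,
        OF edge_form_commute LR(3,4) f_def]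
    ultimately have "alpha_form \<alpha> (parcs ?G) x \<le> alpha_form \<alpha> (parcs ?H) (x \<circ> f)"
      unfolding formG formH comp_apply by simp
    note cmp = rho_compare[OF G ne H pos max bij this]
    have "rho \<alpha> ?G \<noteq> rho \<alpha> ?H"
    proof
      assume "rho \<alpha> ?G = rho \<alpha> ?H"
      \<comment> \<open>At \<open>Suc R\<close> the two equations differ only in the left neighbour,
        which carries x L after the reversal and x R before it. Equality would contradict x R < x
        L.\<close>
      then have "alpha_op \<alpha> (parcs ?H) (x \<circ> f) (Suc R) = alpha_op \<alpha> (parcs ?G) x (f (Suc R))"
        by (intro cmp(2)) (use LR n in auto)
      moreover have "f (Suc R) = Suc R" "f (Suc (Suc R)) = Suc (Suc R)" "f R = L"
        using LR by (auto simp: f_def)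
      moreover have "i \<le> R" using LR im by simp
      ultimately have "(1 - \<alpha>) * x L = (1 - \<alpha>) * x R"
        using LR by (cases "Suc R < d") (simp_all add: alpha_op_broom_path)
      then show False using \<alpha> gt by simp
    qed
    with cmp(1) show ?thesis by simp
  qed
qed

text \<open>Since \<open>rho_broom_less\<close> is strict, equality leaves only brooms that coincide
  with the central one, possibly after a reflection. Centres in the right half are reflected
  first.\<close>

lemma rho_broom_le_central:
  assumes \<alpha>: "0 \<le> \<alpha>" "\<alpha> < 1" and c: "c \<le> d" "d < n"
  shows "rho \<alpha> (broom n d c) \<le> rho \<alpha> (broom n d (d div 2)) \<and>
    (rho \<alpha> (broom n d c) = rho \<alpha> (broom n d (d div 2)) \<longrightarrow>
      (\<exists>f. graph_iso f (broom n d c) (broom n d (d div 2))))"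
proof -
  let ?m = "d div 2"
  have left: "rho \<alpha> (broom n d i) \<le> rho \<alpha> (broom n d ?m) \<and>
    (rho \<alpha> (broom n d i) = rho \<alpha> (broom n d ?m) \<longrightarrow> (\<exists>f. graph_iso f (broom n d i) (broom n d ?m)))"
    if "i \<le> ?m" for i
  \<comment> \<open>If \<open>n = Suc d\<close> there are no pendant vertices, and every centre
    gives the same path.\<close>
  proof (cases "i = ?m \<or> n = Suc d")
    case True
    then have "{(i, j) |j. d < j \<and> j < n} = {(?m, j) |j. d < j \<and> j < n}" by auto
    then have "broom n d i = broom n d ?m" by (simp only: broom_def)
    moreover have "graph_iso id G G" for G :: "nat pair_pre_digraph"
      by (simp add: graph_iso_def)
    ultimately show ?thesis by auto
  next
    case False
    then have "rho \<alpha> (broom n d i) < rho \<alpha> (broom n d ?m)"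
      using that c by (intro rho_broom_less[OF \<alpha>]) auto
    then show ?thesis by simp
  qed
  show ?thesis
  proof (cases "c \<le> ?m")
    case True
    then show ?thesis by (rule left)
  next
    case False
    obtain f where f: "graph_iso f (broom n d c) (broom n d (d - c))"
      using broom_reflect[OF c(2,1)] by blast
    have "rho \<alpha> (broom n d (d - c)) = rho \<alpha> (broom n d c)"
      using c by (intro rho_graph_iso[OF f]) (auto intro!: pair_graph_broom)
    moreover have "d - c \<le> ?m" using False by simp
    ultimately show ?thesis
      using left[of "d - c"] graph_iso_trans[OF f] by metis
  qed
qed

section \<open>Rooted trees\<close>

lemma undirected_tree_connected:
  assumes "undirected_tree T" "u \<in> pverts T" "v \<in> pverts T"
  shows "u \<rightarrow>\<^sup>*\<^bsub>with_proj T\<^esub> v"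
proof -
  interpret pair_graph T using assms(1) by (simp add: undirected_tree_def)
  have "u \<rightarrow>\<^sup>*\<^bsub>with_proj (mk_symmetric (with_proj T))\<^esub> v"
    using assms by (simp add: undirected_tree_def Digraph_Component.connected_def strongly_connected_def)
  then show ?thesis
    using reachable_mk_symmetric_eq[OF pair_sym_arcs] by simp
qed

text \<open>Otherwise a simple path from a to b in F, closed by the arc (b, a), would be a cycle of
  length at least 3. Hence a symmetric set of arcs of the tree that connects all vertices contains
  every arc.\<close>

lemma undirected_tree_arc_in_connected_subset:
  assumes T: "undirected_tree T" and F: "F \<subseteq> parcs T" and ab: "(a, b) \<in> parcs T"
    and conn: "(a, b) \<in> F\<^sup>*"
  shows "(a, b) \<in> F \<or> (b, a) \<in> F"
proof (rule ccontr)
  assume notF: "\<not> ((a, b) \<in> F \<or> (b, a) \<in> F)"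
  interpret pair_graph T using T by (simp add: undirected_tree_def)
  have F_V: "F \<subseteq> pverts T \<times> pverts T"
    using F T pair_graph_arcs_subset[of T] by (auto simp: undirected_tree_def)
  define H where "H = \<lparr>pverts = pverts T, parcs = F\<rparr>"
  interpret H: pair_wf_digraph H
    using F_V by unfold_locales (auto simp: H_def)
  have V: "a \<in> pverts T" "b \<in> pverts T" "a \<noteq> b"
    using wellformed'[OF ab] pair_no_loops[OF ab] by auto
  have "a \<rightarrow>\<^sup>*\<^bsub>with_proj H\<^esub> b"
    unfolding reachable_def using conn V F_V
    by (intro rtrancl_consistent_rtrancl_on) (auto simp: H_def)
  then obtain p where p: "H.apath a p b"
    using H.reachable_apath by auto
  then have pF: "set p \<subseteq> F" and cas: "pcas a p b" and dist: "distinct (pawalk_verts a p)"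
    unfolding H.apath_def H.awalk_def by (auto simp: H_def)
  \<comment> \<open>An empty path would give a = b, and a single arc would be (a, b) itself. The
    closing arc then brings the length to at least 3.\<close>
  have len: "length p \<ge> 2"
  proof (rule ccontr)
    assume "\<not> length p \<ge> 2"
    then consider "p = []" | e where "p = [e]"
      by (cases p; cases "tl p") auto
    then show False
    proof cases
      case 1
      then show False using cas V by simp
    next
      case 2
      then have "e = (a, b)" using cas by (auto simp: prod_eq_iff)
      then show False using 2 pF notF by auto
    qed
  qed
  let ?q = "p @ [(b, a)]"
  have "(b, a) \<in> parcs T"
    using ab pair_sym_arcs by (auto simp: symmetric_def dest: symD)
  then have "awalk b [(b, a)] a"
    using V by (simp add: awalk_def)
  moreover have "awalk a p b"
    using pF F cas V by (auto simp: awalk_def)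
  ultimately have walk: "awalk a ?q a"
    by (intro awalk_appendI)
  have hd: "pawalk_verts a p = a # tl (pawalk_verts a p)"
    using cas len by (cases p) auto
  then have "a \<notin> set (tl (pawalk_verts a p))"
    using dist by (metis distinct.simps(2))
  moreover have "pawalk_verts a ?q = pawalk_verts a p @ [a]"
    using awalk_verts_append[OF walk] by simp
  moreover have "distinct (tl (pawalk_verts a p))"
    using dist by (rule distinct_tl)
  moreover have "pawalk_verts a p \<noteq> []"
    by (subst hd) simp
  ultimately have "distinct (tl (pawalk_verts a ?q))"
    by simp
  with walk have "cycle ?q"
    unfolding cycle_def by auto
  moreover have "length ?q \<ge> 3" using len by simp
  ultimately show False
    using T unfolding undirected_tree_def by blast
qed

text \<open>Each vertex other than z picks a neighbour closer to z. The strict decrease excludes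
  mutual parents, and the parent edges already connect everything to z, so they are all edges of the
  tree.\<close>

lemma undirected_tree_parent:
  assumes T: "undirected_tree T" and z: "z \<in> pverts T"
  obtains p where "\<And>w. w \<in> pverts T - {z} \<Longrightarrow> p w \<in> pverts T \<and> p w \<noteq> w"
    "\<And>w. w \<in> pverts T - {z} \<Longrightarrow> p w \<in> pverts T - {z} \<Longrightarrow> p (p w) \<noteq> w"
    "parcs T = symcl ((\<lambda>w. (w, p w)) ` (pverts T - {z}))"
proof -
  interpret pair_graph T using T by (simp add: undirected_tree_def)
  let ?V = "pverts T" and ?E = "parcs T"
  define depth where "depth w = (LEAST k. (w, z) \<in> ?E ^^ k)" for w
  have "\<exists>u. (w, u) \<in> ?E \<and> depth u < depth w" if w: "w \<in> ?V - {z}" for w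
  proof -
    have "(w, z) \<in> ?E\<^sup>*"
      using reachable_rtranclI[OF undirected_tree_connected[OF T _ z]] w by simp
    then obtain k where "(w, z) \<in> ?E ^^ k"
      using rtrancl_imp_relpow by blast
    then have dw: "(w, z) \<in> ?E ^^ depth w"
      unfolding depth_def by (rule LeastI)
    then obtain k where k: "depth w = Suc k"
      using w by (cases "depth w") auto
    then obtain u where "(w, u) \<in> ?E" "(u, z) \<in> ?E ^^ k"
      using dw by (metis relpow_Suc_D2)
    moreover from this(2) have "depth u \<le> k"
      unfolding depth_def by (rule Least_le)
    ultimately show ?thesis using k by auto
  qed
  then obtain p where p: "\<And>w. w \<in> ?V - {z} \<Longrightarrow> (w, p w) \<in> ?E \<and> depth (p w) < depth w"
    by metis
  define F where "F = symcl ((\<lambda>w. (w, p w)) ` (?V - {z}))"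
  have E_sym: "(v, u) \<in> ?E" if "(u, v) \<in> ?E" for u v
    using that pair_sym_arcs by (auto simp: symmetric_def dest: symD)
  have FE: "F \<subseteq> ?E"
  proof (rule subrelI)
    fix u v assume "(u, v) \<in> F"
    then consider "u \<in> ?V - {z}" "v = p u" | "v \<in> ?V - {z}" "u = p v"
      by (auto simp: F_def in_symcl_iff)
    then show "(u, v) \<in> ?E"
      using p E_sym by cases blast+
  qed
  have F_sym: "sym F"
    by (auto simp: F_def in_symcl_iff sym_def)
  have F_conn: "(w, z) \<in> F\<^sup>*" if "w \<in> ?V" for w
    using that
  proof (induction "depth w" arbitrary: w rule: less_induct)
    case less
    show ?case
    proof (cases "w = z")
      case False
      then have "w \<in> ?V - {z}" using less.prems by simp
      then have "(w, p w) \<in> F" "p w \<in> ?V" "depth (p w) < depth w"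
        using p[of w] wellformed'[of w "p w"] by (simp_all add: F_def in_symcl_iff)
      with less.hyps show ?thesis
        by (meson converse_rtrancl_into_rtrancl)
    qed simp
  qed
  have "?E \<subseteq> F"
  proof (rule subrelI)
    fix a b assume ab: "(a, b) \<in> ?E"
    then have "(a, z) \<in> F\<^sup>*" "(z, b) \<in> F\<^sup>*"
      using F_conn[of a] F_conn[of b] wellformed'[OF ab] sym_rtrancl[OF F_sym] by (auto dest: symD)
    then have "(a, b) \<in> F\<^sup>*" by (rule rtrancl_trans)
    then have "(a, b) \<in> F \<or> (b, a) \<in> F"
      using undirected_tree_arc_in_connected_subset[OF T FE ab] by blast
    then show "(a, b) \<in> F" using F_sym by (auto dest: symD)
  qed
  with FE have "?E = F" by blast
  moreover have "p w \<in> ?V \<and> p w \<noteq> w" if "w \<in> ?V - {z}" for w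
    using p[OF that] wellformed' by auto
  moreover have "p (p w) \<noteq> w" if "w \<in> ?V - {z}" "p w \<in> ?V - {z}" for w
    using p[OF that(1)] p[OF that(2)] by auto
  ultimately show thesis
    using that unfolding F_def by blast
qed

section \<open>Paths of length d and their position in a rooted tree\<close>

text \<open>If every path had fewer than d edges, all distances, being integers, would be at most d
  - 1, and so would their supremum. A path with at least d edges is then cut to its first d.\<close>

lemma graph_diameter_path:
  assumes T: "undirected_tree T" and diam: "graph_diameter T = ereal (real d)"
  obtains v where "inj_on v {..d}" "v ` {..d} \<subseteq> pverts T"
    "\<And>j. j < d \<Longrightarrow> (v j, v (Suc j)) \<in> parcs T"
proof -
  interpret pair_graph T using T by (simp add: undirected_tree_def)
  have path: "\<exists>p. apath u p v \<and> \<mu> (\<lambda>_. 1) u v = ereal (real (length p))"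
    if "u \<in> pverts T" "v \<in> pverts T" for u v
  proof -
    have "awalk_cost (\<lambda>_. 1) p = real (length p)" for p
      by (simp add: awalk_cost_def sum_list_triv)
    then show ?thesis
      using min_cost_awalk[OF undirected_tree_connected[OF T that], of "\<lambda>_. 1"] by simp
  qed
  have "\<exists>u\<in>pverts T. \<exists>v\<in>pverts T. \<exists>p. apath u p v \<and> d \<le> length p"
  proof (rule ccontr)
    assume "\<not> ?thesis"
    then have short: "length p < d" if "u \<in> pverts T" "v \<in> pverts T" "apath u p v" for u v p
      using that by (metis not_le)
    have "\<mu> (\<lambda>_. 1) u v \<le> ereal (real d - 1)" if uv: "u \<in> pverts T" "v \<in> pverts T" for u v
    proof -
      obtain p where "apath u p v" "\<mu> (\<lambda>_. 1) u v = ereal (real (length p))"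
        using path[OF uv] by blast
      with short[OF uv] show ?thesis by fastforce
    qed
    then have "graph_diameter T \<le> ereal (real d - 1)"
      unfolding graph_diameter_def by (intro SUP_least) auto
    then show False using diam by simp
  qed
  then obtain u w p where p: "apath u p w" "d \<le> length p"
    by blast
  then have cas: "pcas u p w" and dist: "distinct (pawalk_verts u p)" and sub: "set p \<subseteq> parcs T"
    by (auto simp: apath_def awalk_def)
  let ?vs = "pawalk_verts u p"
  have len: "length ?vs = Suc (length p)"
    by (rule length_awalk_verts)
  have "(?vs ! j, ?vs ! Suc j) = p ! j" if "j < length p" for j
    using cas that
  proof (induction p arbitrary: u j)
    case (Cons e p)
    then show ?case
      by (cases j; cases p) (auto simp: prod_eq_iff)
  qed simp
  then have arcs: "(?vs ! j, ?vs ! Suc j) \<in> parcs T" if "j < length p" for j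
    using that sub by (metis nth_mem subsetD)
  show thesis
  proof (rule that[of "(!) ?vs"])
    show "inj_on ((!) ?vs) {..d}"
      using dist len p(2) by (auto simp: inj_on_def nth_eq_iff_index_eq)
    have "set ?vs \<subseteq> pverts T"
      using p(1) by (auto simp: apath_def)
    then show "(!) ?vs ` {..d} \<subseteq> pverts T"
      using len p(2) by (auto simp: subset_iff)
    show "(?vs ! j, ?vs ! Suc j) \<in> parcs T" if "j < d" for j
      using arcs that p(2) by simp
  qed
qed

text \<open>This labels all vertices of a tree once some labels are prescribed: the complements have
  equal size and are matched arbitrarily.\<close>

lemma bij_betw_extend:
  assumes fin: "finite A" "finite B" "card A = card B" and C: "C \<subseteq> A" "inj_on g C" "g ` C \<subseteq> B"
  obtains f where "bij_betw f A B" "\<And>c. c \<in> C \<Longrightarrow> f c = g c"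
proof -
  have "card (A - C) = card (B - g ` C)"
    using fin C by (simp add: card_Diff_subset finite_subset card_image)
  then obtain h where h: "bij_betw h (A - C) (B - g ` C)"
    using fin by (meson finite_Diff finite_same_card_bij)
  define f where "f a = (if a \<in> C then g a else h a)" for a
  have "bij_betw f C (g ` C)"
    using C(2) by (auto simp: bij_betw_def f_def inj_on_def)
  moreover have "bij_betw f (A - C) (B - g ` C)"
    using h by (rule bij_betw_cong[THEN iffD1, rotated]) (simp add: f_def)
  ultimately have "bij_betw f (C \<union> (A - C)) (g ` C \<union> (B - g ` C))"
    by (rule bij_betw_combine) auto
  moreover have "C \<union> (A - C) = A" "g ` C \<union> (B - g ` C) = B"
    using C by auto
  ultimately show thesis
    using that[of f] by (simp add: f_def)
qed

text \<open>Once the path steps from a parent to a child it cannot climb again: the parent is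
  unique, and by injectivity the next vertex differs from the previous one.\<close>

lemma rooted_path_turning_point:
  assumes inj: "inj_on v {..d}"
    and edge: "\<And>j. j < d \<Longrightarrow> (v j \<noteq> z \<and> p (v j) = v (Suc j)) \<or> (v (Suc j) \<noteq> z \<and> p (v (Suc j)) = v j)"
  obtains i where "i \<le> d" "\<And>j. j < i \<Longrightarrow> v j \<noteq> z \<and> p (v j) = v (Suc j)"
    "\<And>j. i \<le> j \<Longrightarrow> j < d \<Longrightarrow> v (Suc j) \<noteq> z \<and> p (v (Suc j)) = v j"
proof -
  \<comment> \<open>The disjunct d \<le> j makes \<open>D d\<close> true, so that a path that only
    climbs turns at i = d.\<close>
  define D where "D j \<longleftrightarrow> d \<le> j \<or> v (Suc j) \<noteq> z \<and> p (v (Suc j)) = v j" for j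
  define i where "i = (LEAST j. D j)"
  have "D d" by (simp add: D_def)
  then have "D i" "i \<le> d"
    unfolding i_def by (rule LeastI, rule Least_le)
  have up: "v j \<noteq> z \<and> p (v j) = v (Suc j)" if "j < i" for j
  proof -
    have "\<not> D j" using that not_less_Least unfolding i_def by blast
    then show ?thesis using edge[of j] by (auto simp: D_def)
  qed
  have "D j" if "i \<le> j" for j
    using that
  proof (induction j rule: dec_induct)
    case (step j)
    show ?case
    proof (cases "Suc j < d")
      case True
      have "v (Suc (Suc j)) \<noteq> v j"
        using inj True by (auto dest!: inj_onD)
      then show ?thesis
        using step.IH edge[OF True] True by (auto simp: D_def)
    qed (simp add: D_def)
  qed (rule \<open>D i\<close>)
  then show thesis
    using that[OF \<open>i \<le> d\<close> up] by (meson D_def not_le)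
qed

section \<open>Comparison of a tree with a broom\<close>

text \<open>The bijection f labels the tree by the broom, with z at the centre c. In the broom each
  other vertex either keeps its parent or becomes a child of z, where x is largest, so the form
  cannot decrease. The bound 2 \<le> d leaves room for an inner centre.\<close>

lemma rho_tree_le_broom:
  assumes T: "undirected_tree T" and \<alpha>: "0 \<le> \<alpha>" "\<alpha> < 1" and d: "2 \<le> d"
    and v: "inj_on v {..d}" "v ` {..d} \<subseteq> pverts T" "\<And>j. j < d \<Longrightarrow> (v j, v (Suc j)) \<in> parcs T"
  obtains c where "c \<le> d" "rho \<alpha> T \<le> rho \<alpha> (broom (card (pverts T)) d c)"
    "rho \<alpha> T = rho \<alpha> (broom (card (pverts T)) d c) \<Longrightarrow> \<exists>f. graph_iso f (broom (card (pverts T)) d c) T"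
proof -
  let ?V = "pverts T" and ?E = "parcs T"
  define n where "n = card ?V"
  have G: "pair_graph T" using T by (simp add: undirected_tree_def)
  have ne: "?V \<noteq> {}" using v(2) by auto
  interpret sym_graph ?V ?E
    using G ne by (rule pair_graph_sym_graph)
  have "card (v ` {..d}) \<le> n"
    unfolding n_def using v(2) finite_V by (intro card_mono)
  then have dn: "d < n"
    using card_image[OF v(1)] by simp
  obtain x where pos: "\<And>w. w \<in> ?V \<Longrightarrow> x w > 0"
    and max: "alpha_form \<alpha> ?E x = rho \<alpha> T * sq_norm ?V x"
    by (rule rho_positive_maximiser[OF G ne \<alpha>])
      (use reachable_rtranclI[OF undirected_tree_connected[OF T]] in auto)
  obtain z where z: "z \<in> ?V" and z_max: "\<And>w. w \<in> ?V \<Longrightarrow> x w \<le> x z"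
  proof -
    have "Max (x ` ?V) \<in> x ` ?V" using finite_V ne by (intro Max_in) auto
    then obtain z where "z \<in> ?V" "x z = Max (x ` ?V)" by auto
    then show thesis using that[of z] finite_V by simp
  qed
  obtain p where p_in: "\<And>w. w \<in> ?V - {z} \<Longrightarrow> p w \<in> ?V \<and> p w \<noteq> w"
    and p_asym: "\<And>w. w \<in> ?V - {z} \<Longrightarrow> p w \<in> ?V - {z} \<Longrightarrow> p (p w) \<noteq> w"
    and E_eq: "?E = symcl ((\<lambda>w. (w, p w)) ` (?V - {z}))"
    using undirected_tree_parent[OF T z] by blast
  have E_iff: "(a, b) \<in> ?E \<longleftrightarrow> a \<in> ?V - {z} \<and> b = p a \<or> b \<in> ?V - {z} \<and> a = p b" for a b
    unfolding E_eq in_symcl_iff by auto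
  have "(v j \<noteq> z \<and> p (v j) = v (Suc j)) \<or> (v (Suc j) \<noteq> z \<and> p (v (Suc j)) = v j)" if "j < d" for j
    using v(3)[OF that] unfolding E_iff by auto
  then obtain i where i: "i \<le> d" and up: "\<And>j. j < i \<Longrightarrow> v j \<noteq> z \<and> p (v j) = v (Suc j)"
    and down': "\<And>j. i \<le> j \<Longrightarrow> j < d \<Longrightarrow> v (Suc j) \<noteq> z \<and> p (v (Suc j)) = v j"
    using rooted_path_turning_point[OF v(1), of z p] by blast
  have down: "v j \<noteq> z \<and> p (v j) = v (j - 1)" if "i < j" "j \<le> d" for j
    using down'[of "j - 1"] that by (cases j) auto
  \<comment> \<open>If the turning point is an end of the path, the inner vertex next to it serves equally well:
    only the parents of the \<open>v j\<close> at distance at least 2 from the centre matter.\<close>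
  define c where "c = max 1 (min (d - 1) i)"
  have c: "1 \<le> c" "c < d" "2 \<le> c \<Longrightarrow> c \<le> i" "c + 2 \<le> d \<Longrightarrow> i \<le> c"
    using d i by (auto simp: c_def)
  \<comment> \<open>The labels whose vertex is prescribed. If z is the path vertex at another label,
    that label stays free, because z already sits at c; \<open>v c\<close>, if different from z,
    gets some free label.\<close>
  define C where "C = insert c {j. j \<le> d \<and> j \<noteq> c \<and> v j \<noteq> z}"
  have "\<exists>f. bij_betw f {0..<n} ?V \<and> (\<forall>j\<in>C. f j = (if j = c then z else v j))"
  proof (rule bij_betw_extend[of "{0..<n}" ?V C "\<lambda>j. if j = c then z else v j"])
    show "C \<subseteq> {0..<n}" using dn c by (auto simp: C_def)
    show "inj_on (\<lambda>j. if j = c then z else v j) C"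
      using v(1) by (auto simp: C_def inj_on_def)
    show "(\<lambda>j. if j = c then z else v j) ` C \<subseteq> ?V"
      using v(2) z by (auto simp: C_def)
  qed (use finite_V in \<open>auto simp: n_def\<close>)
  then obtain f where bij: "bij_betw f {0..<n} ?V" and fC: "\<And>j. j \<in> C \<Longrightarrow> f j = (if j = c then z else v j)"
    by blast
  have fc: "f c = z" using fC[of c] by (simp add: C_def)
  have fv: "f j = v j" if "j \<le> d" "j \<noteq> c" "v j \<noteq> z" for j
    using fC[of j] that by (simp add: C_def)
  have f_inj: "f j = f k \<longleftrightarrow> j = k" if "j < n" "k < n" for j k
    using bij that by (auto simp: bij_betw_def inj_on_def)
  have f_in: "f j \<in> ?V" if "j < n" for j
    using bij that by (auto simp: bij_betw_def)
  have bij': "bij_betw f ({0..<n} - {c}) (?V - {z})"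
    using bij_betw_DiffI[OF bij, of "{c}" "{z}"] fc z c dn by (simp add: bij_betw_def)
  let ?q = "broom_parent d c"
  have q_less: "?q j < n" if "j < n" for j
    using that c dn by (auto simp: broom_parent_def)
  \<comment> \<open>A label whose parent is not c lies on the path at distance at least 2 from c.
    There the bounds relating c and i ensure that the path climbs towards c and that neither of the
    two vertices is z.\<close>
  have far: "p (f j) = f (?q j)" if "j < n" "j \<noteq> c" "?q j \<noteq> c" for j
  proof -
    have "Suc j < c \<and> ?q j = Suc j \<or> c + 2 \<le> j \<and> j \<le> d \<and> ?q j = j - 1"
      using that by (auto simp: broom_parent_def split: if_splits)
    then consider "Suc j < c" "?q j = Suc j" | "c + 2 \<le> j" "j \<le> d" "?q j = j - 1"
      by blast
    then show ?thesis
    proof cases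
      case 1
      then have "v j \<noteq> z" "v (Suc j) \<noteq> z" "p (v j) = v (Suc j)"
        using c up[of j] up[of "Suc j"] by auto
      then show ?thesis using 1 c fv[of j] fv[of "Suc j"] by simp
    next
      case 2
      then have "v j \<noteq> z" "v (j - 1) \<noteq> z" "p (v j) = v (j - 1)"
        using c down[of j] down[of "j - 1"] by auto
      then show ?thesis using 2 c fv[of j] fv[of "j - 1"] by simp
    qed
  qed
  let ?B = "broom n d c"
  have B: "pair_graph ?B"
    using dn c by (intro pair_graph_broom) auto
  have "alpha_form \<alpha> ?E x = (\<Sum>w\<in>?V - {z}. edge_form \<alpha> (x w) (x (p w)))"
    unfolding E_eq using p_in p_asym finite_V by (intro alpha_form_parent) auto
  also have "\<dots> = (\<Sum>j\<in>{0..<n} - {c}. edge_form \<alpha> (x (f j)) (x (p (f j))))"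
    by (rule sum.reindex_bij_betw[OF bij', symmetric])
  also have "\<dots> \<le> (\<Sum>j\<in>{0..<n} - {c}. edge_form \<alpha> (x (f j)) (x (f (?q j))))"
  proof (rule sum_mono)
    fix j assume j: "j \<in> {0..<n} - {c}"
    then have "f j \<in> ?V - {z}" using bij' by (auto simp: bij_betw_def)
    then have "p (f j) \<in> ?V" "f j \<in> ?V" using p_in by auto
    then show "edge_form \<alpha> (x (f j)) (x (p (f j))) \<le> edge_form \<alpha> (x (f j)) (x (f (?q j)))"
      using far[of j] j fc z_max pos \<alpha> by (cases "?q j = c") (auto intro!: edge_form_mono)
  qed
  also have "\<dots> = alpha_form \<alpha> (parcs ?B) (x \<circ> f)"
    using alpha_form_broom_parent[of d n c \<alpha> "x \<circ> f"] dn c by simp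
  finally have le: "alpha_form \<alpha> ?E x \<le> alpha_form \<alpha> (parcs ?B) (x \<circ> f)" .
  have "bij_betw f (pverts ?B) ?V" using bij by simp
  note cmp = rho_compare[OF G ne B pos max this le]
  have "\<exists>f. graph_iso f ?B T" if eq: "rho \<alpha> T = rho \<alpha> ?B"
  proof -
    have op: "alpha_op \<alpha> (parcs ?B) (x \<circ> f) c = alpha_op \<alpha> ?E x (f c)"
      by (rule cmp(2)) (use eq c dn in auto)
    interpret B: sym_graph "pverts ?B" "parcs ?B"
      using B dn by (intro pair_graph_sym_graph) auto
    have B_iff: "(j, k) \<in> parcs ?B \<longleftrightarrow> j \<in> {0..<n} - {c} \<and> k = ?q j \<or> k \<in> {0..<n} - {c} \<and> j = ?q k" for j k
      using broom_arcs_parent[of d n c] dn c unfolding in_symcl_iff by (auto simp: in_symcl_iff)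
    define N where "N = parcs ?B `` {c}"
    have N_n: "N \<subseteq> {0..<n}" using B.E_subset by (auto simp: N_def)
    have fN: "f ` N \<subseteq> ?V" using N_n f_in by auto
    \<comment> \<open>Every neighbour of the root z is a child of z; by \<open>far\<close> its label
      must be adjacent to c.\<close>
    have sub: "?E `` {z} \<subseteq> f ` N"
    proof
      fix w assume "w \<in> ?E `` {z}"
      then have w: "w \<in> ?V - {z}" "p w = z" using E_iff by auto
      from w(1) obtain j where j: "j \<in> {0..<n} - {c}" "w = f j"
        unfolding bij_betw_imp_surj_on[OF bij', symmetric] by blast
      have "?q j = c"
      proof (rule ccontr)
        assume "?q j \<noteq> c"
        then have "f (?q j) = f c" using far[of j] j w fc by auto
        then show False using \<open>?q j \<noteq> c\<close> f_inj[of "?q j" c] q_less[of j] j c dn by simp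
      qed
      then show "w \<in> f ` N" using j by (auto simp: N_def B_iff)
    qed
    have "alpha_op \<alpha> (parcs ?B) (x \<circ> f) c = (\<Sum>w\<in>f ` N. \<alpha> * x z + (1 - \<alpha>) * x w)"
    proof -
      have "inj_on f N" using N_n bij by (auto simp: bij_betw_def intro: inj_on_subset)
      then show ?thesis by (simp add: alpha_op_def N_def sum.reindex card_image fc)
    qed
    then have sum_eq: "(\<Sum>w\<in>f ` N. \<alpha> * x z + (1 - \<alpha>) * x w) = (\<Sum>w\<in>?E `` {z}. \<alpha> * x z + (1 - \<alpha>) * x w)"
      using op unfolding alpha_op_def[of \<alpha> ?E] fc by simp
    have term_pos: "0 < \<alpha> * x z + (1 - \<alpha>) * x w" if "w \<in> ?V" for w
      using \<alpha> pos[OF z] pos[OF that] by (intro add_nonneg_pos) auto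
    \<comment> \<open>The sums over the two neighbourhoods agree and all terms are positive, so the
      inclusion \<open>sub\<close> cannot be strict: every vertex made a child of z was one
      already.\<close>
    have "f ` N \<subseteq> ?E `` {z}"
    proof (rule ccontr)
      assume "\<not> f ` N \<subseteq> ?E `` {z}"
      then obtain w where w: "w \<in> f ` N - ?E `` {z}" by auto
      have "(\<Sum>w\<in>?E `` {z}. \<alpha> * x z + (1 - \<alpha>) * x w) < (\<Sum>w\<in>f ` N. \<alpha> * x z + (1 - \<alpha>) * x w)"
      proof (rule sum_strict_mono2[OF _ sub w])
        show "finite (f ` N)" using B.finite_nbrs by (simp add: N_def)
      qed (use w fN term_pos less_imp_le in blast)+
      then show False using sum_eq by simp
    qed
    then have "p (f j) = f (?q j)" if "j < n" "j \<noteq> c" for j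
    proof (cases "?q j = c")
      case True
      then have "j \<in> N" using that by (auto simp: N_def B_iff)
      then have "(z, f j) \<in> ?E" using \<open>f ` N \<subseteq> ?E `` {z}\<close> by auto
      then show ?thesis using True fc by (auto simp: E_iff)
    qed (use far that in auto)
    moreover have "f j = z \<longleftrightarrow> j = c" if "j < n" for j
      using f_inj[of j c] that fc c dn by simp
    ultimately have "(j, k) \<in> parcs ?B \<longleftrightarrow> (f j, f k) \<in> ?E" if "j < n" "k < n" for j k
      unfolding B_iff E_iff using that f_inj q_less f_in by (auto simp: f_inj q_less)
    then have "graph_iso f ?B T"
      using bij by (simp add: graph_iso_def)
    then show ?thesis by blast
  qed
  moreover have "rho \<alpha> T \<le> rho \<alpha> ?B"
    by (rule cmp(1))
  ultimately show thesis
    using that[of c] c by (simp add: n_def)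
qed

theorem theorem3p7:
  fixes T :: "'a pair_pre_digraph" and n d :: nat and \<alpha> :: real
  assumes "undirected_tree T"
    and "card (pverts T) = n"
    and "graph_diameter T = ereal (real d)"
    and "3 \<le> d"
    and "0 \<le> \<alpha>" and "\<alpha> < 1"
  shows "rho \<alpha> T \<le> rho \<alpha> (T_tree n d) \<and>
    (rho \<alpha> T = rho \<alpha> (T_tree n d) \<longleftrightarrow>
       digraph_iso (with_proj T) (with_proj (T_tree n d)))"
proof -
  obtain v where v: "inj_on v {..d}" "v ` {..d} \<subseteq> pverts T" "\<And>j. j < d \<Longrightarrow> (v j, v (Suc j)) \<in> parcs T"
    using graph_diameter_path[OF assms(1,3)] by blast
  have T: "pair_graph T" using assms(1) by (simp add: undirected_tree_def)
  then interpret pair_graph T .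
  have ne: "pverts T \<noteq> {}" using v(2) by auto
  have "card (v ` {..d}) \<le> n"
    using card_mono[OF pair_finite_verts v(2)] assms(2) by simp
  then have dn: "d < n" using card_image[OF v(1)] by simp
  have central: "pair_graph (T_tree n d)"
    unfolding T_tree_eq_broom using dn by (intro pair_graph_broom) auto
  have d2: "2 \<le> d" using assms(4) by simp
  obtain c where c: "c \<le> d" "rho \<alpha> T \<le> rho \<alpha> (broom n d c)"
    "rho \<alpha> T = rho \<alpha> (broom n d c) \<Longrightarrow> \<exists>f. graph_iso f (broom n d c) T"
    using rho_tree_le_broom[OF assms(1,5,6) d2 v] assms(2) by blast
  note le_central = rho_broom_le_central[OF assms(5,6) c(1) dn, folded T_tree_eq_broom]
  show ?thesis
    unfolding digraph_iso_with_proj_iff[OF T central]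
  proof (intro conjI iffI)
    show "rho \<alpha> T \<le> rho \<alpha> (T_tree n d)"
      using c(2) le_central by linarith
    \<comment> \<open>Equality of the outer terms of the chain through \<open>broom n d c\<close>
      forces equality in both steps, and the two resulting isomorphisms compose.\<close>
    assume eq: "rho \<alpha> T = rho \<alpha> (T_tree n d)"
    then have "rho \<alpha> T = rho \<alpha> (broom n d c)" "rho \<alpha> (broom n d c) = rho \<alpha> (T_tree n d)"
      using c(2) le_central by linarith+
    then show "\<exists>f. graph_iso f T (T_tree n d)"
      using c(3) le_central by (meson graph_iso_sym graph_iso_trans)
  next
    assume "\<exists>f. graph_iso f T (T_tree n d)"
    then show "rho \<alpha> T = rho \<alpha> (T_tree n d)"
      using rho_graph_iso[OF _ T ne central] by metis
  qed
qed

end
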